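(* Let $\mathbb F$ be a finite field of characteristic $p$. There are an absolute constant $c>0$ (approximately $1/200$) and constants $C_1,C_2>0$ depending only on $p$ such that the following holds. Let $\epsilon,\epsilon'>0$ with $1/\epsilon$ an integer, let $0<\delta<c$, let $n=1/\epsilon$ and $\alpha=C_2\sqrt{\epsilon/\delta}$ with $\alpha\le1/2$, and let $d\le C_1\sqrt{\delta/\epsilon}$. Let $\mathcal F$ be the class of tests $x\mapsto \mathbf 1[P(x)\neq0]$ on $\{0,1\}^n$, where $P\in\mathbb F[X_1,\dots,X_n]$ has degree at most $d$. Then $\mathbf N_\alpha$ is $(\epsilon',\delta)$-pseudodense with respect to $\mathcal F$, but $\mathbf N_\alpha$ is not $\delta$-dense in any random variable that is $\epsilon$-pseudorandom for $\mathcal F$.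
   Context: $\mathbf N_\alpha$ is the product of $n$ independent Bernoulli random variables each equal to $1$ with probability $1/2-\alpha$; $\mathbf U$ is uniform on $\{0,1\}^n$. Polynomials are evaluated only at points of $\{0,1\}^n\subseteq\mathbb F^n$. $(\epsilon',\delta)$-pseudodense: $\delta\Pr[P(\mathbf N_\alpha)\ne0]\le\Pr[P(\mathbf U)\ne0]+\epsilon'$ for every such $P$. $\epsilon$-pseudorandom: $|\Pr[P(\mathbf X)\ne0]-\Pr[P(\mathbf U)\ne0]|\le\epsilon$ for every such $P$. $\mathbf Z$ is $\delta$-dense in $\mathbf X$ if $\delta\Pr[\mathbf Z=z]\le\Pr[\mathbf X=z]$ for all $z$.
   Formalization: Non-density is claimed only for d ≥ 1: for d = 0 all tests are constant, so N_α is itself ε-pseudorandom and δ-dense in itself, and the claim fails. The finite field is taken, up to isomorphism, with natural numbers as elements. *)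

theory Defs
  imports
    "HOL-Probability.Probability"
    "HOL-Algebra.Indexed_Polynomials"
    "HOL-Algebra.Multiplicative_Group"
    "HOL-Computational_Algebra.Primes"
begin

section \<open>Finite fields\<close>

definition ring_char :: "('a, 'b) ring_scheme \<Rightarrow> nat" where
  "ring_char R = group.ord (add_monoid R) \<one>\<^bsub>R\<^esub>"

text \<open>
  A constant that is to depend on the characteristic alone has to be chosen before the field, and
  HOL does not quantify over types inside a formula.  The field is therefore a record with carrier
  in the fixed type \<^typ>\<open>nat\<close>; by the next lemma this covers every finite field up to isomorphism.
\<close>

lemma finite_field_iso_nat:
  fixes R :: "('a, 'b) ring_scheme"
  assumes "field R" and "finite (carrier R)"
  shows "\<exists>F :: nat ring. field F \<and> finite (carrier F) \<and> R \<simeq> F"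
proof -
  obtain f :: "'a \<Rightarrow> nat" where f: "inj_on f (carrier R)"
    using finite_imp_inj_to_nat_seg[OF assms(2)] by blast
  have "field (image_ring f R)"
    by (rule field.inj_imp_image_ring_is_field[OF assms(1) f])
  moreover have "finite (carrier (image_ring f R))"
    using assms(2) by (simp add: image_ring_carrier)
  moreover have "R \<simeq> image_ring f R"
    using inj_imp_image_ring_iso[OF f]
    by (auto simp: is_ring_iso_def)
  ultimately show ?thesis by blast
qed


section \<open>Polynomials in several variables\<close>

text \<open>
  As in \<^theory>\<open>HOL-Algebra.Indexed_Polynomials\<close>, a polynomial is the function taking a monomial,
  i.e. a multiset of variables, to its coefficient.
\<close>

definition mpoly_eval :: "('a, 'b) ring_scheme \<Rightarrow> ('c multiset \<Rightarrow> 'a) \<Rightarrow> ('c \<Rightarrow> 'a) \<Rightarrow> 'a" where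
  "mpoly_eval R P v =
     (\<Oplus>\<^bsub>R\<^esub>m\<in>{m. P m \<noteq> \<zero>\<^bsub>R\<^esub>}. P m \<otimes>\<^bsub>R\<^esub> (\<Otimes>\<^bsub>R\<^esub>i\<in>set_mset m. v i [^]\<^bsub>R\<^esub> count m i))"

definition mpoly_degree_le :: "('a, 'b) ring_scheme \<Rightarrow> ('c multiset \<Rightarrow> 'a) \<Rightarrow> nat \<Rightarrow> bool" where
  "mpoly_degree_le R P d \<longleftrightarrow> (\<forall>m. P m \<noteq> \<zero>\<^bsub>R\<^esub> \<longrightarrow> size m \<le> d)"


section \<open>Distributions on the cube\<close>

text \<open>
  A point of the cube is a function that is \<^const>\<open>False\<close> from \<open>n\<close> on, the convention of
  \<^const>\<open>Pi_pmf\<close>; \<^const>\<open>True\<close> stands for the bit 1.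
\<close>

definition cube :: "nat \<Rightarrow> (nat \<Rightarrow> bool) set" where
  "cube n = PiE_dflt {..<n} False (\<lambda>_. UNIV)"

definition uniform_cube :: "nat \<Rightarrow> (nat \<Rightarrow> bool) pmf" where
  "uniform_cube n = pmf_of_set (cube n)"

definition biased_cube :: "nat \<Rightarrow> real \<Rightarrow> (nat \<Rightarrow> bool) pmf" where
  "biased_cube n \<alpha> = Pi_pmf {..<n} False (\<lambda>_. bernoulli_pmf (1 / 2 - \<alpha>))"

definition poly_tests :: "('a, 'b) ring_scheme \<Rightarrow> nat \<Rightarrow> nat \<Rightarrow> ((nat \<Rightarrow> bool) \<Rightarrow> bool) set" where
  "poly_tests R n d =
     {\<lambda>x. mpoly_eval R P (\<lambda>i. if x i then \<one>\<^bsub>R\<^esub> else \<zero>\<^bsub>R\<^esub>) \<noteq> \<zero>\<^bsub>R\<^esub> | P.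
        P \<in> ring.indexed_pset R {..<n} (carrier R) \<and> mpoly_degree_le R P d}"

definition pseudodense ::
    "((nat \<Rightarrow> bool) \<Rightarrow> bool) set \<Rightarrow> nat \<Rightarrow> real \<Rightarrow> real \<Rightarrow> (nat \<Rightarrow> bool) pmf \<Rightarrow> bool" where
  "pseudodense T n \<epsilon>' \<delta> Z \<longleftrightarrow>
     (\<forall>f\<in>T. \<delta> * measure_pmf.prob Z {x. f x} \<le> measure_pmf.prob (uniform_cube n) {x. f x} + \<epsilon>')"

definition pseudorandom ::
    "((nat \<Rightarrow> bool) \<Rightarrow> bool) set \<Rightarrow> nat \<Rightarrow> real \<Rightarrow> (nat \<Rightarrow> bool) pmf \<Rightarrow> bool" where
  "pseudorandom T n \<epsilon> Y \<longleftrightarrow>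
     (\<forall>f\<in>T. \<bar>measure_pmf.prob Y {x. f x} - measure_pmf.prob (uniform_cube n) {x. f x}\<bar> \<le> \<epsilon>)"

definition dense_in :: "real \<Rightarrow> 'a pmf \<Rightarrow> 'a pmf \<Rightarrow> bool" where
  "dense_in \<delta> Z Y \<longleftrightarrow> (\<forall>z. \<delta> * pmf Z z \<le> pmf Y z)"

end

theory Submission
  imports Defs
begin

text \<open>
  Write \<open>E\<close> for the nonzero set on the cube of a polynomial \<open>P\<close> of degree at most \<open>d\<close>, and \<open>h r\<close>
  for the dimension of the space of functions on \<open>E\<close> of degree at most \<open>r\<close>.  Interpolation gives
  \<open>|{x \<in> E. |x| \<le> k}| \<le> h k\<close>; orthogonality under the alternating sum over the cube, weighted by
  \<open>P\<close>, gives \<open>h k + h (n - 1 - d - k) \<le> |E|\<close>; and \<open>h r\<close> is at least the proportion of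
  monomials of degree at most \<open>r\<close>, times \<open>|E|\<close>.  Together: the weight of a random point of \<open>E\<close>
  stochastically dominates the weight of a random point of the cube, lowered by \<open>d\<close>.  Integrating the
  density of the biased distribution against this yields
  \<open>(1/2 - \<alpha>)\<^sup>d Pr[P(N) \<noteq> 0] \<le> (1/2 + \<alpha>)\<^sup>d Pr[P(U) \<noteq> 0]\<close>, and \<open>\<alpha> d \<le> 1/4\<close> bounds the ratio by \<open>9\<close>.

  Conversely the tests \<open>x\<^sub>i - x\<^sub>j\<close> force the sum of the signs \<open>(-1)\<^bsup>x\<^sub>i\<^esup>\<close> under a pseudorandom
  variable to have second moment at most \<open>3n\<close>, whereas a \<open>\<delta>\<close>-dense copy of the biased
  distribution alone contributes \<open>\<delta> (2 \<alpha> n)\<^sup>2 = 4n\<close>.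
\<close>

section \<open>Low-degree functions on the cube\<close>

text \<open>A point of the cube is encoded by the set of its coordinates equal to 1, so the product
  of the variables in \<open>S\<close> is the indicator of \<open>S \<subseteq> x\<close>. A bit
  equals its positive powers, hence square-free monomials span everything; carrying the coefficient
  in the generator leaves addition as the only closure rule.\<close>

inductive_set lowdeg :: "('a, 'b) ring_scheme \<Rightarrow> 'c set \<Rightarrow> nat \<Rightarrow> ('c set \<Rightarrow> 'a) set"
  for R (structure) and A d where
    monomial: "\<lbrakk>finite S; S \<subseteq> A; card S \<le> d; c \<in> carrier R\<rbrakk>
      \<Longrightarrow> (\<lambda>x. if S \<subseteq> x then c else \<zero>) \<in> lowdeg R A d"
  | add: "\<lbrakk>f \<in> lowdeg R A d; g \<in> lowdeg R A d\<rbrakk> \<Longrightarrow> (\<lambda>x. f x \<oplus> g x) \<in> lowdeg R A d"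

context cring
begin

lemma lowdeg_closed: "f \<in> lowdeg R A d \<Longrightarrow> f x \<in> carrier R"
  by (induction rule: lowdeg.induct) auto

lemma lowdeg_const: "c \<in> carrier R \<Longrightarrow> (\<lambda>_. c) \<in> lowdeg R A d"
  using lowdeg.monomial[of "{}" A d c R] by simp

lemma lowdeg_mono:
  assumes "f \<in> lowdeg R A d" "A \<subseteq> B" "d \<le> e"
  shows "f \<in> lowdeg R B e"
  using assms
proof (induction rule: lowdeg.induct)
  case (monomial S c)
  then show ?case by (intro lowdeg.monomial) auto
next
  case (add f g)
  then show ?case by (intro lowdeg.add)
qed

lemma lowdeg_a_inv: "f \<in> lowdeg R A d \<Longrightarrow> (\<lambda>x. \<ominus> f x) \<in> lowdeg R A d"
proof (induction rule: lowdeg.induct)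
  case (monomial S c)
  then have "(\<lambda>x. if S \<subseteq> x then \<ominus> c else \<zero>) \<in> lowdeg R A d"
    by (intro lowdeg.monomial) auto
  also have "(\<lambda>x. if S \<subseteq> x then \<ominus> c else \<zero>) = (\<lambda>x. \<ominus> (if S \<subseteq> x then c else \<zero>))"
    by auto
  finally show ?case .
next
  case (add f g)
  then have "(\<lambda>x. \<ominus> f x \<oplus> \<ominus> g x) \<in> lowdeg R A d"
    by (intro lowdeg.add)
  also have "(\<lambda>x. \<ominus> f x \<oplus> \<ominus> g x) = (\<lambda>x. \<ominus> (f x \<oplus> g x))"
    using add by (auto simp: lowdeg_closed minus_add)
  finally show ?case .
qed

lemma lowdeg_minus:
  assumes "f \<in> lowdeg R A d" "g \<in> lowdeg R A d"
  shows "(\<lambda>x. f x \<ominus> g x) \<in> lowdeg R A d"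
  unfolding a_minus_def using assms lowdeg_a_inv by (intro lowdeg.add)

lemma lowdeg_finsum:
  assumes "finite I" "\<And>i. i \<in> I \<Longrightarrow> f i \<in> lowdeg R A d"
  shows "(\<lambda>x. \<Oplus>i\<in>I. f i x) \<in> lowdeg R A d"
  using assms
proof (induction I rule: finite_induct)
  case empty
  then show ?case by (simp add: lowdeg_const)
next
  case (insert i I)
  then have "(\<lambda>x. f i x \<oplus> (\<Oplus>i\<in>I. f i x)) \<in> lowdeg R A d"
    by (intro lowdeg.add) auto
  also have "(\<lambda>x. f i x \<oplus> (\<Oplus>i\<in>I. f i x)) = (\<lambda>x. \<Oplus>i\<in>insert i I. f i x)"
    using insert by (subst finsum_insert) (auto intro!: lowdeg_closed)
  finally show ?case .
qed

text \<open>On bits the product of the monomials of \<open>S\<close> and \<open>T\<close> is the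
  monomial of \<open>S \<union> T\<close>, whose degree is at most the sum. This is the inner of the
  two inductions behind \<open>lowdeg_mult\<close>.\<close>

lemma lowdeg_monomial_mult:
  assumes "f \<in> lowdeg R A d" "finite S" "S \<subseteq> A" "card S + d \<le> e" "c \<in> carrier R"
  shows "(\<lambda>x. (if S \<subseteq> x then c else \<zero>) \<otimes> f x) \<in> lowdeg R A e"
  using assms
proof (induction rule: lowdeg.induct)
  case (monomial T b)
  then have "(\<lambda>x. if S \<union> T \<subseteq> x then c \<otimes> b else \<zero>) \<in> lowdeg R A e"
    using card_Un_le[of S T] by (intro lowdeg.monomial) auto
  also have "(\<lambda>x. if S \<union> T \<subseteq> x then c \<otimes> b else \<zero>)
      = (\<lambda>x. (if S \<subseteq> x then c else \<zero>) \<otimes> (if T \<subseteq> x then b else \<zero>))"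
    using monomial by auto
  finally show ?case .
next
  case (add f g)
  then have "(\<lambda>x. (if S \<subseteq> x then c else \<zero>) \<otimes> f x \<oplus> (if S \<subseteq> x then c else \<zero>) \<otimes> g x)
      \<in> lowdeg R A e"
    by (intro lowdeg.add) auto
  also have "(\<lambda>x. (if S \<subseteq> x then c else \<zero>) \<otimes> f x \<oplus> (if S \<subseteq> x then c else \<zero>) \<otimes> g x)
      = (\<lambda>x. (if S \<subseteq> x then c else \<zero>) \<otimes> (f x \<oplus> g x))"
    using add by (auto simp: lowdeg_closed r_distr)
  finally show ?case .
qed

lemma lowdeg_mult:
  assumes "f \<in> lowdeg R A d" "g \<in> lowdeg R A e"
  shows "(\<lambda>x. f x \<otimes> g x) \<in> lowdeg R A (d + e)"
  using assms
proof (induction rule: lowdeg.induct)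
  case (monomial S c)
  then show ?case by (intro lowdeg_monomial_mult) auto
next
  case (add f h)
  then have "(\<lambda>x. f x \<otimes> g x \<oplus> h x \<otimes> g x) \<in> lowdeg R A (d + e)"
    by (intro lowdeg.add) auto
  also have "(\<lambda>x. f x \<otimes> g x \<oplus> h x \<otimes> g x) = (\<lambda>x. (f x \<oplus> h x) \<otimes> g x)"
    using add by (auto simp: lowdeg_closed l_distr)
  finally show ?case .
qed

lemma lowdeg_insert_cong:
  assumes "f \<in> lowdeg R A d" "a \<notin> A"
  shows "f (insert a x) = f x"
  using assms by (induction rule: lowdeg.induct) (auto simp: subset_insert)

section \<open>Alternating sums and interpolation\<close>

definition alt_sign :: "'c set \<Rightarrow> 'a" where
  "alt_sign x = (if even (card x) then \<one> else \<ominus> \<one>)"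

lemma alt_sign_closed [simp, intro]: "alt_sign x \<in> carrier R"
  by (simp add: alt_sign_def)

text \<open>The subsets of \<open>A\<close> come in pairs \<open>x\<close>,
  \<open>insert a x\<close>, and each pair cancels.\<close>

lemma finsum_Pow_toggle:
  assumes "finite A" "a \<in> A" "\<And>x. F x \<in> carrier R"
    and "\<And>x. a \<notin> x \<Longrightarrow> x \<subseteq> A \<Longrightarrow> F (insert a x) = \<ominus> F x"
  shows "(\<Oplus>x\<in>Pow A. F x) = \<zero>"
proof -
  define B where "B = A - {a}"
  have B: "A = insert a B" "a \<notin> B" "finite B"
    using assms by (auto simp: B_def)
  have inj: "inj_on (insert a) (Pow B)"
    using B by (auto simp: inj_on_def)
  have "(\<Oplus>x\<in>Pow A. F x) = (\<Oplus>x\<in>Pow B. F x) \<oplus> (\<Oplus>x\<in>insert a ` Pow B. F x)"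
    unfolding B(1) Pow_insert using B assms(3) by (intro finsum_Un_disjoint) auto
  also have "(\<Oplus>x\<in>insert a ` Pow B. F x) = (\<Oplus>x\<in>Pow B. F (insert a x))"
    using assms(3) by (intro finsum_reindex inj) auto
  also have "\<dots> = (\<Oplus>x\<in>Pow B. \<ominus> F x)"
    using assms B by (intro finsum_cong' refl) auto
  also have "(\<Oplus>x\<in>Pow B. F x) \<oplus> \<dots> = (\<Oplus>x\<in>Pow B. F x \<oplus> \<ominus> F x)"
    using assms(3) by (intro finsum_addf[symmetric]) auto
  also have "\<dots> = (\<Oplus>x\<in>Pow B. \<zero>)"
    using assms(3) by (intro finsum_cong' refl) (auto simp: r_neg)
  finally show ?thesis by simp
qed

text \<open>A monomial of degree below |A| misses some coordinate; toggling that coordinate flips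
  the sign and keeps the value of the monomial.\<close>

lemma lowdeg_alternating_sum:
  assumes "f \<in> lowdeg R A d" "finite A" "d < card A"
  shows "(\<Oplus>x\<in>Pow A. alt_sign x \<otimes> f x) = \<zero>"
  using assms
proof (induction rule: lowdeg.induct)
  case (monomial S c)
  then have "S \<noteq> A" by auto
  with monomial obtain a where a: "a \<in> A" "a \<notin> S" by blast
  show ?case
  proof (rule finsum_Pow_toggle[OF \<open>finite A\<close> \<open>a \<in> A\<close>])
    fix x assume x: "a \<notin> x" "x \<subseteq> A"
    then have "finite x" using monomial finite_subset by blast
    then have "card (insert a x) = Suc (card x)" using x by simp
    then show "alt_sign (insert a x) \<otimes> (if S \<subseteq> insert a x then c else \<zero>) =
        \<ominus> (alt_sign x \<otimes> (if S \<subseteq> x then c else \<zero>))"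
      using a monomial by (auto simp: alt_sign_def subset_insert l_minus)
  qed (use monomial in auto)
next
  case (add f g)
  have "(\<Oplus>x\<in>Pow A. alt_sign x \<otimes> (f x \<oplus> g x)) =
      (\<Oplus>x\<in>Pow A. alt_sign x \<otimes> f x \<oplus> alt_sign x \<otimes> g x)"
    using add by (intro finsum_cong' refl) (auto simp: lowdeg_closed r_distr)
  also have "\<dots> = (\<Oplus>x\<in>Pow A. alt_sign x \<otimes> f x) \<oplus> (\<Oplus>x\<in>Pow A. alt_sign x \<otimes> g x)"
    using add by (intro finsum_addf) (auto simp: lowdeg_closed)
  finally show ?case using add by simp
qed

text \<open>Points and monomials, both indexed by sets, form a triangular system when ordered by
  cardinality: with points added by nondecreasing weight, the monomial of a new point vanishes at
  all earlier ones and corrects the value at the new point alone.\<close>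

lemma lowdeg_interpolate:
  assumes "finite L" "\<And>x. x \<in> L \<Longrightarrow> finite x \<and> x \<subseteq> A \<and> card x \<le> k"
    and "\<And>x. x \<in> L \<Longrightarrow> u x \<in> carrier R"
  shows "\<exists>f\<in>lowdeg R A k. \<forall>x\<in>L. f x = u x"
  using assms
proof (induction L rule: finite_ranking_induct[where f = card])
  case empty
  show ?case using lowdeg_const[OF zero_closed] by blast
next
  case (insert a L)
  then obtain f where f: "f \<in> lowdeg R A k" "\<forall>x\<in>L. f x = u x" by auto
  show ?case
  proof (cases "a \<in> L")
    case True
    then show ?thesis using f by (auto simp: insert_absorb)
  next
    case False
    let ?g = "\<lambda>x. f x \<oplus> (if a \<subseteq> x then u a \<ominus> f a else \<zero>)"
    have car: "f x \<in> carrier R" "u a \<in> carrier R" for x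
      using f insert by (auto simp: lowdeg_closed)
    have "?g \<in> lowdeg R A k"
      using insert f car by (intro lowdeg.add lowdeg.monomial) auto
    moreover have "?g x = u x" if "x \<in> insert a L" for x
    proof (cases "x = a")
      case True
      have "f a \<oplus> (u a \<ominus> f a) = u a"
        using car by algebra
      then show ?thesis using True by simp
    next
      case neq: False
      then have "x \<in> L" using that by blast
      \<comment> \<open>The order of insertion gives |x| \<le> |a|, so
        \<open>a \<subseteq> x\<close> would force \<open>x = a\<close>.\<close>
      have "\<not> a \<subseteq> x"
        using insert.hyps(2)[OF \<open>x \<in> L\<close>] insert.prems(1)[of x] \<open>x \<in> L\<close> neq
          psubset_card_mono[of x a] card_seteq[of x a] by auto
      have "f x = u x" using f(2) \<open>x \<in> L\<close> by blast
      then show ?thesis using \<open>\<not> a \<subseteq> x\<close> r_zero[OF car(1)[of x]] by simp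
    qed
    ultimately show ?thesis by (intro bexI[of _ ?g] ballI)
  qed
qed

section \<open>Functions restricted to a set of points, with cardinality in place of
  dimension\<close>

definition lowdeg_on :: "'c set \<Rightarrow> nat \<Rightarrow> 'c set set \<Rightarrow> ('c set \<Rightarrow> 'a) set" where
  "lowdeg_on A d E = (\<lambda>f. restrict f E) ` lowdeg R A d"

lemma lowdeg_on_subset: "lowdeg_on A d E \<subseteq> E \<rightarrow>\<^sub>E carrier R"
  by (auto simp: lowdeg_on_def lowdeg_closed)

lemma finite_lowdeg_on:
  assumes "finite (carrier R)" "finite E"
  shows "finite (lowdeg_on A d E)"
  by (rule finite_subset[OF lowdeg_on_subset]) (use assms in \<open>auto intro: finite_PiE\<close>)

text \<open>By interpolation, restriction to \<open>L\<close> maps \<open>lowdeg_on A k E\<close>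
  onto all functions from \<open>L\<close> to the ring.\<close>

lemma card_lowdeg_on_ge_interpolation:
  assumes "finite (carrier R)" "finite E" "L \<subseteq> E"
    and "\<And>x. x \<in> L \<Longrightarrow> finite x \<and> x \<subseteq> A \<and> card x \<le> k"
  shows "card (carrier R) ^ card L \<le> card (lowdeg_on A k E)"
proof -
  have finL: "finite L" using assms finite_subset by blast
  have "L \<rightarrow>\<^sub>E carrier R \<subseteq> (\<lambda>f. restrict f L) ` lowdeg_on A k E"
  proof
    fix u assume u: "u \<in> L \<rightarrow>\<^sub>E carrier R"
    then obtain f where f: "f \<in> lowdeg R A k" "\<forall>x\<in>L. f x = u x"
      using lowdeg_interpolate[OF finL assms(4)] by (metis PiE_mem)
    have "restrict (restrict f E) L = u"
      using f u \<open>L \<subseteq> E\<close> by (auto simp: fun_eq_iff restrict_def PiE_def extensional_def)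
    moreover have "restrict f E \<in> lowdeg_on A k E"
      using f by (simp add: lowdeg_on_def)
    ultimately show "u \<in> (\<lambda>f. restrict f L) ` lowdeg_on A k E"
      by (metis imageI)
  qed
  then have "card (L \<rightarrow>\<^sub>E carrier R) \<le> card (lowdeg_on A k E)"
    using surj_card_le[OF finite_lowdeg_on[OF assms(1,2)]] by blast
  then show ?thesis using finL by (simp add: card_PiE)
qed

end

text \<open>This is dim V + dim W \<le> |E| for spaces orthogonal under a nondegenerate diagonal
  form, with cardinalities for dimensions. The induction removes one point of \<open>E\<close>,
  which accounts for a factor |R| in either \<open>V\<close> or \<open>W\<close>, never in
  both.\<close>

lemma (in domain) card_orthogonal_le:
  assumes "finite E" "finite (carrier R)"
    and "V \<subseteq> E \<rightarrow>\<^sub>E carrier R" "W \<subseteq> E \<rightarrow>\<^sub>E carrier R"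
    and "\<And>f g. f \<in> V \<Longrightarrow> g \<in> V \<Longrightarrow> (\<lambda>x\<in>E. f x \<ominus> g x) \<in> V"
    and "\<And>x. x \<in> E \<Longrightarrow> c x \<in> carrier R - {\<zero>}"
    and "\<And>f g. f \<in> V \<Longrightarrow> g \<in> W \<Longrightarrow> (\<Oplus>x\<in>E. c x \<otimes> f x \<otimes> g x) = \<zero>"
  shows "card V * card W \<le> card (carrier R) ^ card E"
  using assms
proof (induction E arbitrary: V W rule: finite_induct)
  case empty
  then have "card V \<le> card {\<lambda>x::'c. undefined :: 'a}" "card W \<le> card {\<lambda>x::'c. undefined :: 'a}"
    by (intro card_mono; auto)+
  then show ?case using mult_le_mono by fastforce
next
  case (insert e E)
  let ?q = "card (carrier R)"
  let ?r = "\<lambda>f. restrict f E"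
  note fin = insert.hyps(1) and e = insert.hyps(2)
  note V = insert.prems(2) and W = insert.prems(3) and sub = insert.prems(4)
    and c = insert.prems(5) and orth = insert.prems(6)
  have finPE: "finite (insert e E \<rightarrow>\<^sub>E carrier R)"
    using fin \<open>finite (carrier R)\<close> by (intro finite_PiE) auto
  have finV: "finite V" and finW: "finite W"
    using finite_subset[OF V finPE] finite_subset[OF W finPE] by auto
  have Vc: "f x \<in> carrier R" if "f \<in> V" "x \<in> insert e E" for f x
    using V that by blast
  have Wc: "f x \<in> carrier R" if "f \<in> W" "x \<in> insert e E" for f x
    using W that by blast
  have cc: "c x \<in> carrier R" if "x \<in> insert e E" for x
    using c that by blast
  have cm: "c x \<otimes> f x \<otimes> g x \<in> carrier R" if "f \<in> V" "g \<in> W" "x \<in> insert e E" for f g x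
    using Vc[OF that(1,3)] Wc[OF that(2,3)] cc[OF that(3)] by simp
  have insert_ext: "f = g" if "f \<in> insert e E \<rightarrow>\<^sub>E carrier R" "g \<in> insert e E \<rightarrow>\<^sub>E carrier R"
    "f e = g e" "?r f = ?r g" for f g
  proof (rule PiE_ext[OF that(1,2)])
    fix x assume "x \<in> insert e E"
    then show "f x = g x" using that(3) fun_cong[OF that(4), of x] by auto
  qed
  have sum_split: "(\<Oplus>x\<in>E. c x \<otimes> f x \<otimes> g x) \<in> carrier R"
    "c e \<otimes> f e \<otimes> g e \<oplus> (\<Oplus>x\<in>E. c x \<otimes> f x \<otimes> g x) = \<zero>"
    if "f \<in> V" "g \<in> W" for f g
  proof -
    have "(\<Oplus>x\<in>insert e E. c x \<otimes> f x \<otimes> g x) =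
        c e \<otimes> f e \<otimes> g e \<oplus> (\<Oplus>x\<in>E. c x \<otimes> f x \<otimes> g x)"
      using fin e cm[OF that] by (intro finsum_insert) auto
    then show "c e \<otimes> f e \<otimes> g e \<oplus> (\<Oplus>x\<in>E. c x \<otimes> f x \<otimes> g x) = \<zero>"
      using orth[OF that] by simp
  qed (use cm[OF that] in \<open>auto intro!: finsum_closed\<close>)
  have restr_sum: "(\<Oplus>x\<in>E. c x \<otimes> ?r f x \<otimes> ?r g x) = (\<Oplus>x\<in>E. c x \<otimes> f x \<otimes> g x)"
    if "f \<in> V" "g \<in> W" for f g
    using cm[OF that] by (intro finsum_cong' refl) auto
  have r_PiE: "?r ` S \<subseteq> E \<rightarrow>\<^sub>E carrier R" if "S \<subseteq> insert e E \<rightarrow>\<^sub>E carrier R" for S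
    using that by (intro image_subsetI restrict_PiE_iff[THEN iffD2]) blast
  define V0 where "V0 = {f \<in> V. f e = \<zero>}"
  have V0: "V0 \<subseteq> V" by (auto simp: V0_def)
  have inj_V0: "inj_on ?r V0"
    by (rule inj_onI, rule insert_ext) (use V in \<open>auto simp: V0_def\<close>)
  have sub0: "(\<lambda>x\<in>E. f x \<ominus> g x) \<in> ?r ` V0" if "f \<in> ?r ` V0" "g \<in> ?r ` V0" for f g
  proof -
    from that obtain f' g' where fg: "f = ?r f'" "g = ?r g'" "f' \<in> V0" "g' \<in> V0" by blast
    let ?h = "\<lambda>x\<in>insert e E. f' x \<ominus> g' x"
    have f'g': "f' \<in> V" "f' e = \<zero>" "g' \<in> V" "g' e = \<zero>"
      using fg(3,4) by (simp_all add: V0_def)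
    have "?h e = \<zero>"
      using f'g' by (simp add: a_minus_def)
    with sub[OF f'g'(1,3)] have "?h \<in> V0"
      unfolding V0_def by blast
    then have "?r ?h \<in> ?r ` V0" by (rule imageI)
    moreover have "(\<lambda>x\<in>E. f x \<ominus> g x) = ?r ?h"
      unfolding fg(1,2) by (rule ext) (simp add: restrict_def)
    ultimately show ?thesis by simp
  qed
  \<comment> \<open>The term at \<open>e\<close> is zero for functions in \<open>V0\<close>, so
    orthogonality passes to the remaining points.\<close>
  have orth0: "(\<Oplus>x\<in>E. c x \<otimes> f x \<otimes> g x) = \<zero>" if "f \<in> ?r ` V0" "g \<in> ?r ` W" for f g
  proof -
    from that obtain f' g' where fg: "f = ?r f'" "g = ?r g'" "f' \<in> V0" "g' \<in> W" by blast
    have f': "f' \<in> V" "f' e = \<zero>" using fg(3) by (simp_all add: V0_def)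
    then show ?thesis
      unfolding fg(1,2) restr_sum[OF f'(1) fg(4)]
      using sum_split[OF f'(1) fg(4)] Wc[OF fg(4), of e] cc[of e] by simp
  qed
  have "card (?r ` V0) * card (?r ` W) \<le> ?q ^ card E"
    by (rule insert.IH[OF \<open>finite (carrier R)\<close> r_PiE[OF order.trans[OF V0 V]] r_PiE[OF W] sub0 c orth0])
      auto
  then have IH: "card V0 * card (?r ` W) \<le> ?q ^ card E"
    by (simp add: card_image[OF inj_V0])
  have "card V * card W \<le> ?q * (card V0 * card (?r ` W))"
  proof (cases "V0 = V")
    \<comment> \<open>All of \<open>V\<close> vanishes at \<open>e\<close>, so only \<open>W\<close>
      has a free value there and pays one factor for it.\<close>
    case True
    have "inj_on (\<lambda>g. (g e, ?r g)) W"
      by (rule inj_onI, rule insert_ext) (use W in auto)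
    then have "card W \<le> card (carrier R \<times> ?r ` W)"
      using Wc \<open>finite (carrier R)\<close> finW by (intro card_inj_on_le) auto
    then show ?thesis using True by (simp add: card_cartesian_product mult.left_commute)
  next
    case False
    then obtain f0 where f0: "f0 \<in> V" "f0 e \<noteq> \<zero>" using V0 by (auto simp: V0_def)
    \<comment> \<open>Orthogonality to \<open>f0\<close>, with \<open>c e\<close> and
      \<open>f0 e\<close> nonzero, determines \<open>g e\<close> from the values of \<open>g\<close>
      on \<open>E\<close>.\<close>
    have "inj_on ?r W"
    proof (intro inj_onI)
      fix g h assume gh: "g \<in> W" "h \<in> W" "?r g = ?r h"
      let ?s = "\<Oplus>x\<in>E. c x \<otimes> f0 x \<otimes> g x"
      have "(\<Oplus>x\<in>E. c x \<otimes> f0 x \<otimes> h x) = ?s"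
        using restr_sum[OF f0(1) gh(1)] restr_sum[OF f0(1) gh(2)] gh(3) by simp
      then have "c e \<otimes> f0 e \<otimes> g e \<oplus> ?s = c e \<otimes> f0 e \<otimes> h e \<oplus> ?s"
        using sum_split[OF f0(1) gh(1)] sum_split[OF f0(1) gh(2)] by simp
      then have "c e \<otimes> f0 e \<otimes> g e = c e \<otimes> f0 e \<otimes> h e"
        using sum_split(1)[OF f0(1) gh(1)] f0 gh Vc Wc cc by (subst (asm) add.right_cancel) auto
      moreover have "c e \<otimes> f0 e \<noteq> \<zero>" "c e \<otimes> f0 e \<in> carrier R"
        using c[of e] f0 Vc[of f0 e] integral by auto
      ultimately have "g e = h e"
        using m_lcancel gh Wc by (metis insertI1)
      then show "g = h" using gh W by (intro insert_ext[of g h]) auto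
    qed
    then have cardW: "card (?r ` W) = card W" by (rule card_image)
    \<comment> \<open>One representative is fixed per value at \<open>e\<close>; subtracting it
      carries \<open>f\<close> into \<open>V0\<close>, so \<open>V\<close> is covered by at most |R|
      translates of \<open>V0\<close>.\<close>
    define rep where "rep a = (SOME f. f \<in> V \<and> f e = a)" for a
    have rep: "rep (f e) \<in> V" "rep (f e) e = f e" if "f \<in> V" for f
      using someI[of "\<lambda>g. g \<in> V \<and> g e = f e" f] that by (auto simp: rep_def)
    let ?\<phi> = "\<lambda>f. (f e, \<lambda>x\<in>insert e E. f x \<ominus> rep (f e) x)"
    have "inj_on ?\<phi> V"
    proof (intro inj_onI)
      fix f g assume fg: "f \<in> V" "g \<in> V" "?\<phi> f = ?\<phi> g"
      then have eq: "f e = g e" "(\<lambda>x\<in>insert e E. f x \<ominus> rep (f e) x)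
          = (\<lambda>x\<in>insert e E. g x \<ominus> rep (f e) x)"
        by auto
      show "f = g"
      proof (rule PiE_ext[OF subsetD[OF V fg(1)] subsetD[OF V fg(2)]])
        fix x assume x: "x \<in> insert e E"
        then have "f x \<ominus> rep (f e) x = g x \<ominus> rep (f e) x"
          using fun_cong[OF eq(2), of x] by auto
        then show "f x = g x"
          unfolding a_minus_def using x fg rep Vc by (subst (asm) add.right_cancel) auto
      qed
    qed
    moreover have "?\<phi> f \<in> carrier R \<times> V0" if "f \<in> V" for f
    proof -
      let ?h = "\<lambda>x\<in>insert e E. f x \<ominus> rep (f e) x"
      have "?h e = \<zero>"
        using rep[OF that] Vc[OF that, of e] by (simp add: r_neg a_minus_def)
      with sub[OF that rep(1)[OF that]] have "?h \<in> V0"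
        unfolding V0_def by blast
      then show ?thesis using Vc[OF that, of e] by simp
    qed
    ultimately have "card V \<le> card (carrier R \<times> V0)"
      using \<open>finite (carrier R)\<close> finite_subset[OF V0 finV] by (intro card_inj_on_le) auto
    then show ?thesis using cardW by (simp add: card_cartesian_product mult.assoc[symmetric])
  qed
  also have "\<dots> \<le> ?q ^ card (insert e E)"
    using IH fin e by simp
  finally show ?case .
qed

section \<open>Hilbert functions\<close>

definition choose_upto :: "nat \<Rightarrow> nat \<Rightarrow> nat" where
  "choose_upto n r = (\<Sum>j\<le>r. n choose j)"

lemma choose_upto_0 [simp]: "choose_upto n 0 = 1"
  by (simp add: choose_upto_def)

lemma choose_upto_Suc_Suc:
  "choose_upto (Suc n) (Suc r) = choose_upto n (Suc r) + choose_upto n r"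
proof -
  have "choose_upto (Suc n) (Suc r) = 1 + (\<Sum>j\<le>r. (n choose Suc j) + (n choose j))"
    by (simp add: choose_upto_def sum.atMost_Suc_shift add.commute del: sum.atMost_Suc)
  also have "\<dots> = choose_upto n (Suc r) + choose_upto n r"
    by (simp add: choose_upto_def sum.atMost_Suc_shift sum.distrib del: sum.atMost_Suc)
  finally show ?thesis .
qed

lemma choose_upto_mono: "r \<le> s \<Longrightarrow> choose_upto n r \<le> choose_upto n s"
  by (auto simp: choose_upto_def intro!: sum_mono2)

lemma choose_upto_ge: "n \<le> r \<Longrightarrow> choose_upto n r = 2 ^ n"
proof -
  assume "n \<le> r"
  then have "choose_upto n r = (\<Sum>j\<le>n. n choose j)"
    unfolding choose_upto_def by (intro sum.mono_neutral_right) auto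
  then show ?thesis by (simp add: choose_row_sum)
qed

text \<open>The reflection of \<open>j\<close> to \<open>n - j\<close> turns degrees above
  \<open>r\<close> into degrees at most \<open>n - 1 - r\<close>.\<close>

lemma choose_upto_compl:
  assumes "r < n"
  shows "choose_upto n r + choose_upto n (n - Suc r) = 2 ^ n"
proof -
  have "choose_upto n (n - Suc r) = (\<Sum>j\<in>{Suc r..n}. n choose j)"
    unfolding choose_upto_def
    by (rule sum.reindex_bij_witness[of _ "\<lambda>j. n - j" "\<lambda>j. n - j"])
      (use assms in \<open>auto simp: binomial_symmetric[symmetric]\<close>)
  moreover have "{..n} = {..r} \<union> {Suc r..n}"
    using assms by auto
  ultimately have "choose_upto n r + choose_upto n (n - Suc r) = (\<Sum>j\<le>n. n choose j)"
    by (subst \<open>{..n} = _\<close>, subst sum.union_disjoint) (auto simp: choose_upto_def)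
  then show ?thesis by (simp add: choose_row_sum)
qed

lemma card_subsets_upto:
  assumes "finite A"
  shows "card {x. x \<subseteq> A \<and> card x \<le> r} = choose_upto (card A) r"
proof -
  have "{x. x \<subseteq> A \<and> card x \<le> r} = (\<Union>j\<in>{..r}. {x. x \<subseteq> A \<and> card x = j})"
    by auto
  also have "card \<dots> = (\<Sum>j\<le>r. card {x. x \<subseteq> A \<and> card x = j})"
    using assms by (intro card_UN_disjoint) (auto intro: finite_subset[OF _ finite_Pow_iff[THEN iffD2]])
  finally show ?thesis by (simp add: n_subsets[OF assms] choose_upto_def)
qed

text \<open>\<open>E0\<close> and \<open>E1\<close> are the sections of \<open>E\<close> along
  coordinate \<open>a\<close>. A function f + x_a g, with f and g free of x_a, equals f on one
  section and f + g on the other, so it determines first g on \<open>E0 \<inter> E1\<close> and then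
  f on \<open>E0 \<union> E1\<close>.\<close>

lemma (in cring) card_lowdeg_on_insert:
  assumes fin: "finite (carrier R)" "finite A" and a: "a \<notin> A" and E: "E \<subseteq> Pow (insert a A)"
  defines "E0 \<equiv> {x. a \<notin> x \<and> x \<in> E}" and "E1 \<equiv> {x. a \<notin> x \<and> insert a x \<in> E}"
  shows "card (lowdeg_on A (Suc r) (E0 \<union> E1)) * card (lowdeg_on A r (E0 \<inter> E1))
    \<le> card (lowdeg_on (insert a A) (Suc r) E)"
proof -
  let ?U = "lowdeg_on A (Suc r) (E0 \<union> E1)" and ?I = "lowdeg_on A r (E0 \<inter> E1)"
  have finE: "finite E" using E fin by (meson finite_Pow_iff finite_insert finite_subset)
  have lift_ex: "\<exists>f. f \<in> lowdeg R A d \<and> restrict f S = u" if "u \<in> lowdeg_on A d S" for u d and S :: "'c set set"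
    using that by (auto simp: lowdeg_on_def)
  \<comment> \<open>One extension is chosen for each restricted function, so that equal restrictions
    have extensions agreeing everywhere.\<close>
  define lft where "lft d S u = (SOME f. f \<in> lowdeg R A d \<and> restrict f S = u)" for d u and S :: "'c set set"
  have lft: "lft d S u \<in> lowdeg R A d" "restrict (lft d S u) S = u" if "u \<in> lowdeg_on A d S" for d S u
    using someI_ex[OF lift_ex[OF that]] by (auto simp: lft_def)
  define f where "f = lft (Suc r) (E0 \<union> E1)"
  define g where "g = lft r (E0 \<inter> E1)"
  have f: "f u \<in> lowdeg R A (Suc r)" "\<And>x. x \<in> E0 \<union> E1 \<Longrightarrow> f u x = u x" if "u \<in> ?U" for u
    using lft[OF that] by (auto simp: f_def fun_eq_iff restrict_def split: if_splits)
  have g: "g v \<in> lowdeg R A r" "\<And>x. x \<in> E0 \<inter> E1 \<Longrightarrow> g v x = v x" if "v \<in> ?I" for v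
    using lft[OF that] by (auto simp: g_def fun_eq_iff restrict_def split: if_splits)
  define h where "h u v x = f u x \<oplus> (if {a} \<subseteq> x then \<one> else \<zero>) \<otimes> g v x" for u v x
  have h_in: "restrict (h u v) E \<in> lowdeg_on (insert a A) (Suc r) E" if "u \<in> ?U" "v \<in> ?I" for u v
  proof -
    have "(\<lambda>x. (if {a} \<subseteq> x then \<one> else \<zero>) \<otimes> g v x) \<in> lowdeg R (insert a A) (Suc r)"
      using lowdeg_mono[OF g(1)[OF that(2)], of "insert a A" r]
      by (intro lowdeg_monomial_mult) auto
    then have "h u v \<in> lowdeg R (insert a A) (Suc r)"
      unfolding h_def using lowdeg_mono[OF f(1)[OF that(1)], of "insert a A" "Suc r"]
      by (intro lowdeg.add) auto
    then show ?thesis by (simp add: lowdeg_on_def)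
  qed
  have cl: "f u x \<in> carrier R" "g v x \<in> carrier R" if "u \<in> ?U" "v \<in> ?I" for u v x
    using that f(1) g(1) lowdeg_closed by blast+
  have h0: "h u v x = f u x" if "u \<in> ?U" "v \<in> ?I" "a \<notin> x" for u v x
    using that cl[OF that(1,2), of x] by (simp add: h_def)
  have h1: "h u v (insert a x) = f u x \<oplus> g v x" if "u \<in> ?U" "v \<in> ?I" for u v x
    using that cl[OF that(1,2), of x] lowdeg_insert_cong[OF f(1)[OF that(1)] a]
      lowdeg_insert_cong[OF g(1)[OF that(2)] a] by (simp add: h_def)
  have "inj_on (\<lambda>(u, v). restrict (h u v) E) (?U \<times> ?I)"
  proof (rule inj_onI, safe)
    fix u v u' v'
    assume uv: "u \<in> ?U" "v \<in> ?I" "u' \<in> ?U" "v' \<in> ?I"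
      and eq: "restrict (h u v) E = restrict (h u' v') E"
    have hE: "h u v x = h u' v' x" if "x \<in> E" for x
      using fun_cong[OF eq, of x] that by simp
    have e0: "f u x = f u' x" if "x \<in> E0" for x
      using hE[of x] that uv by (simp add: h0 E0_def)
    have e1: "f u x \<oplus> g v x = f u' x \<oplus> g v' x" if "x \<in> E1" for x
      using hE[of "insert a x"] that uv by (simp add: h1 E1_def)
    show v: "v = v'"
    proof (rule PiE_ext[OF subsetD[OF lowdeg_on_subset uv(2)] subsetD[OF lowdeg_on_subset uv(4)]])
      fix x assume x: "x \<in> E0 \<inter> E1"
      then have "f u x \<oplus> g v x = f u x \<oplus> g v' x"
        using e0[of x] e1[of x] x by simp
      then have "g v x \<oplus> f u x = g v' x \<oplus> f u x"
        using cl uv by (simp add: a_comm)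
      then have "g v x = g v' x" using cl uv by (subst (asm) add.right_cancel) auto
      then show "v x = v' x" using g(2)[OF uv(2) x] g(2)[OF uv(4) x] by simp
    qed
    show "u = u'"
    proof (rule PiE_ext[OF subsetD[OF lowdeg_on_subset uv(1)] subsetD[OF lowdeg_on_subset uv(3)]])
      fix x assume x: "x \<in> E0 \<union> E1"
      \<comment> \<open>With \<open>v = v'\<close> the two extensions coincide also off
        \<open>E0 \<inter> E1\<close>, so their common value cancels on all of
        \<open>E1\<close>.\<close>
      have "f u x = f u' x" if "x \<in> E1"
        using e1[OF that] cl uv unfolding v by (subst (asm) add.right_cancel) auto
      then have "f u x = f u' x" using x e0 by blast
      then show "u x = u' x" using f(2)[OF uv(1) x] f(2)[OF uv(3) x] by simp
    qed
  qed
  then have "card (?U \<times> ?I) \<le> card (lowdeg_on (insert a A) (Suc r) E)"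
    using h_in finite_lowdeg_on[OF fin(1) finE] by (intro card_inj_on_le) auto
  then show ?thesis by (simp add: card_cartesian_product)
qed

lemma card_insert_section:
  fixes E :: "'c set set" and a :: 'c
  assumes "finite E"
  defines "E0 \<equiv> {x. a \<notin> x \<and> x \<in> E}" and "E1 \<equiv> {x. a \<notin> x \<and> insert a x \<in> E}"
  shows "finite E0" "finite E1" "card E = card E0 + card E1"
proof -
  have inj: "inj_on (insert a) E1"
    by (auto simp: inj_on_def E1_def)
  have E: "E = E0 \<union> insert a ` E1"
  proof (intro equalityI subsetI)
    fix x assume "x \<in> E"
    then show "x \<in> E0 \<union> insert a ` E1"
      using image_eqI[of x "insert a" "x - {a}" E1]
      by (cases "a \<in> x") (auto simp: E0_def E1_def insert_absorb)
  qed (auto simp: E0_def E1_def)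
  show "finite E0" using assms(1) E by (metis finite_Un)
  show "finite E1" using assms(1) E inj by (metis finite_Un finite_image_iff)
  then show "card E = card E0 + card E1"
    using \<open>finite E0\<close> card_image[OF inj]
    by (subst E, subst card_Un_disjoint) (auto simp: E0_def)
qed

text \<open>Chebyshev's sum inequality for two terms: the difference of the sides is
  \<open>(u - i) * (b - c)\<close>.\<close>

lemma Chebyshev_two:
  fixes i u b c :: nat
  assumes "i \<le> u" "c \<le> b"
  shows "(u + i) * (b + c) \<le> 2 * (u * b + i * c)"
proof -
  obtain x where "u = i + x" using assms(1) le_Suc_ex by blast
  moreover obtain y where "b = c + y" using assms(2) le_Suc_ex by blast
  ultimately show ?thesis by (simp add: algebra_simps)
qed

text \<open>
  The Hilbert function inequality of Nie and Wang.  Cardinalities \<open>q\<^sup>h\<close> stand in for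
  dimensions \<open>h\<close> over the field with \<open>q\<close> elements.  The induction splits \<open>E\<close> along one
  coordinate into two sections and replaces them by their union and their intersection.
\<close>

lemma (in cring) card_lowdeg_on_ge_Hilbert:
  assumes "finite A" "finite (carrier R)" "E \<subseteq> Pow A"
  shows "\<exists>h. card (carrier R) ^ h \<le> card (lowdeg_on A r E) \<and>
    card E * choose_upto (card A) r \<le> h * 2 ^ card A"
  using assms
proof (induction A arbitrary: E r rule: finite_induct)
  case empty
  then have "card E \<le> 1" "finite E"
    using card_mono[of "{{}}" E] finite_subset[of E "{{}}"] by auto
  moreover from this have "card (carrier R) ^ card E \<le> card (lowdeg_on {} r E)"
    by (intro card_lowdeg_on_ge_interpolation) (use empty in auto)
  ultimately show ?case
    by (intro exI[of _ "card E"]) (auto simp: choose_upto_ge)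
next
  case (insert a A)
  let ?q = "card (carrier R)"
  have finE: "finite E" using insert.prems insert.hyps by (meson finite_Pow_iff finite_insert finite_subset)
  show ?case
  proof (cases r)
    \<comment> \<open>Only constants have degree 0. They give \<open>h = 1\<close> for nonempty
      \<open>E\<close>, and what remains is that \<open>E\<close> is no larger than the
      cube.\<close>
    case 0
    show ?thesis
    proof (cases "E = {}")
      case True
      then show ?thesis
        using card_lowdeg_on_ge_interpolation[of "{}" "{}" "insert a A" r] insert.prems
        by (intro exI[of _ 0]) auto
    next
      case False
      then obtain e where e: "e \<in> E" by blast
      have "card E \<le> 2 ^ card (insert a A)"
        using card_mono[OF _ insert.prems(2)] insert.hyps by (simp add: card_Pow)
      moreover have "card (carrier R) \<le> card (lowdeg_on (insert a A) r E)"
      proof (rule card_inj_on_le)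
        show "inj_on (\<lambda>c. restrict (\<lambda>_. c) E) (carrier R)"
        proof (rule inj_onI)
          fix c d assume "restrict (\<lambda>_. c) E = restrict (\<lambda>_. d) E"
          then have "restrict (\<lambda>_. c) E e = restrict (\<lambda>_. d) E e" by (rule fun_cong)
          then show "c = d" using e by simp
        qed
        show "(\<lambda>c. restrict (\<lambda>_. c) E) ` carrier R \<subseteq> lowdeg_on (insert a A) r E"
          unfolding lowdeg_on_def by (intro image_subsetI imageI lowdeg_const)
        show "finite (lowdeg_on (insert a A) r E)"
          by (rule finite_lowdeg_on[OF insert.prems(1) finE])
      qed
      ultimately show ?thesis using 0 by (intro exI[of _ 1]) auto
    qed
  next
    case (Suc s)
    define E0 where "E0 = {x. a \<notin> x \<and> x \<in> E}"
    define E1 where "E1 = {x. a \<notin> x \<and> insert a x \<in> E}"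
    note sec = card_insert_section[OF finE, of a, folded E0_def E1_def]
    have sub: "E0 \<union> E1 \<subseteq> Pow A" "E0 \<inter> E1 \<subseteq> Pow A"
      using insert.prems(2) insert.hyps(2) by (auto simp: E0_def E1_def)
    obtain h where h: "?q ^ h \<le> card (lowdeg_on A (Suc s) (E0 \<union> E1))"
      "card (E0 \<union> E1) * choose_upto (card A) (Suc s) \<le> h * 2 ^ card A"
      using insert.IH[OF insert.prems(1) sub(1)] by blast
    obtain k where k: "?q ^ k \<le> card (lowdeg_on A s (E0 \<inter> E1))"
      "card (E0 \<inter> E1) * choose_upto (card A) s \<le> k * 2 ^ card A"
      using insert.IH[OF insert.prems(1) sub(2)] by blast
    \<comment> \<open>The union carries the full degree and the intersection one degree less, as it
      holds the cofactor of the variable \<open>a\<close>.\<close>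
    have "?q ^ (h + k) \<le> card (lowdeg_on A (Suc s) (E0 \<union> E1)) * card (lowdeg_on A s (E0 \<inter> E1))"
      unfolding power_add by (intro mult_le_mono h k)
    also have "\<dots> \<le> card (lowdeg_on (insert a A) r E)"
      unfolding Suc E0_def E1_def
      using insert.prems insert.hyps by (intro card_lowdeg_on_insert)
    finally have "?q ^ (h + k) \<le> card (lowdeg_on (insert a A) r E)" .
    moreover have "card E * choose_upto (card (insert a A)) r \<le> (h + k) * 2 ^ card (insert a A)"
    proof -
      let ?u = "card (E0 \<union> E1)" and ?i = "card (E0 \<inter> E1)"
      let ?b = "choose_upto (card A) (Suc s)" and ?c = "choose_upto (card A) s"
      have le: "?i \<le> ?u" "?c \<le> ?b"
        by (intro card_mono; use sec in auto) (simp add: choose_upto_mono)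
      have "card E = ?u + ?i"
        using sec(3) card_Un_Int[OF sec(1,2)] by simp
      moreover have "choose_upto (card (insert a A)) r = ?b + ?c"
        using insert.hyps by (simp add: Suc choose_upto_Suc_Suc)
      \<comment> \<open>Sections and Pascal's rule split both factors; the larger set is paired with
        the larger binomial sum, as Chebyshev's inequality requires.\<close>
      moreover have "(?u + ?i) * (?b + ?c) \<le> 2 * (?u * ?b + ?i * ?c)"
        using le by (rule Chebyshev_two)
      ultimately have "card E * choose_upto (card (insert a A)) r \<le> 2 * (?u * ?b + ?i * ?c)"
        by simp
      also have "\<dots> \<le> 2 * (h * 2 ^ card A + k * 2 ^ card A)"
        using h k by simp
      finally show ?thesis using insert.hyps by (simp add: algebra_simps)
    qed
    ultimately show ?thesis by blast
  qed
qed

text \<open>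
  The low-degree functions on \<open>E\<close> of degrees \<open>k\<close> and \<open>n - 1 - d - k\<close> are orthogonal for the form
  with weights \<open>(-1)\<^bsup>|x|\<^esup> P x\<close>, which is nondegenerate on \<open>E\<close>.
\<close>

lemma (in field) card_low_weight_support_le:
  assumes fin: "finite (carrier R)" "finite A" and P: "P \<in> lowdeg R A d"
  defines "E \<equiv> {x \<in> Pow A. P x \<noteq> \<zero>}"
  shows "card {x \<in> E. card x \<le> k} * 2 ^ card A \<le> card E * choose_upto (card A) (k + d)"
proof -
  let ?n = "card A" and ?q = "card (carrier R)"
  let ?L = "{x \<in> E. card x \<le> k}"
  have finE: "finite E" using fin by (simp add: E_def)
  have cardL: "card ?L \<le> card E" using finE by (intro card_mono) auto
  show ?thesis
  proof (cases "k + d < ?n")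
    \<comment> \<open>Every subset of \<open>A\<close> has size at most \<open>k + d\<close> here,
      so the binomial sum is all of 2^|A|.\<close>
    case False
    then show ?thesis using cardL by (simp add: choose_upto_ge)
  next
    case True
    \<comment> \<open>The largest degree for which a product of degrees \<open>d\<close>,
      \<open>k\<close> and \<open>r\<close> stays below |A|, so that its alternating sum
      vanishes.\<close>
    define r where "r = ?n - Suc (k + d)"
    obtain h where h: "?q ^ h \<le> card (lowdeg_on A r E)"
      "card E * choose_upto ?n r \<le> h * 2 ^ ?n"
      using card_lowdeg_on_ge_Hilbert[of A E r] fin by (auto simp: E_def)
    have "?q ^ card ?L \<le> card (lowdeg_on A k E)"
      using fin finE by (intro card_lowdeg_on_ge_interpolation) (auto simp: E_def intro: finite_subset)
    then have "?q ^ (card ?L + h) \<le> card (lowdeg_on A k E) * card (lowdeg_on A r E)"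
      unfolding power_add using h by (intro mult_le_mono)
    also have "\<dots> \<le> ?q ^ card E"
    proof (rule card_orthogonal_le[OF finE fin(1), where c = "\<lambda>x. alt_sign x \<otimes> P x"])
      show "lowdeg_on A k E \<subseteq> E \<rightarrow>\<^sub>E carrier R" "lowdeg_on A r E \<subseteq> E \<rightarrow>\<^sub>E carrier R"
        by (rule lowdeg_on_subset)+
    next
      fix f g assume "f \<in> lowdeg_on A k E" "g \<in> lowdeg_on A k E"
      then obtain f' g' where fg: "f = restrict f' E" "g = restrict g' E"
        "f' \<in> lowdeg R A k" "g' \<in> lowdeg R A k" by (auto simp: lowdeg_on_def)
      have "(\<lambda>x\<in>E. f x \<ominus> g x) = restrict (\<lambda>x. f' x \<ominus> g' x) E"
        unfolding fg by (auto simp: fun_eq_iff)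
      then show "(\<lambda>x\<in>E. f x \<ominus> g x) \<in> lowdeg_on A k E"
        using lowdeg_minus[OF fg(3,4)] by (auto simp: lowdeg_on_def)
    next
      fix x assume "x \<in> E"
      then show "alt_sign x \<otimes> P x \<in> carrier R - {\<zero>}"
        using lowdeg_closed[OF P, of x] by (auto simp: E_def alt_sign_def l_minus)
    next
      fix f g assume "f \<in> lowdeg_on A k E" "g \<in> lowdeg_on A r E"
      then obtain f' g' where fg: "f = restrict f' E" "g = restrict g' E"
        "f' \<in> lowdeg R A k" "g' \<in> lowdeg R A r" by (auto simp: lowdeg_on_def)
      have cl: "P x \<in> carrier R" "f' x \<in> carrier R" "g' x \<in> carrier R" for x
        using lowdeg_closed P fg by blast+
      have "(\<lambda>x. P x \<otimes> f' x \<otimes> g' x) \<in> lowdeg R A (d + k + r)"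
        by (intro lowdeg_mult P fg)
      moreover have "d + k + r < ?n" using True by (simp add: r_def)
      ultimately have "(\<Oplus>x\<in>Pow A. alt_sign x \<otimes> (P x \<otimes> f' x \<otimes> g' x)) = \<zero>"
        using fin(2) by (intro lowdeg_alternating_sum)
      also have "(\<Oplus>x\<in>Pow A. alt_sign x \<otimes> (P x \<otimes> f' x \<otimes> g' x)) =
          (\<Oplus>x\<in>E. alt_sign x \<otimes> P x \<otimes> f x \<otimes> g x)"
        using fin cl
        by (intro add.finprod_mono_neutral_cong_right) (auto simp: E_def fg m_assoc)
      finally show "(\<Oplus>x\<in>E. alt_sign x \<otimes> P x \<otimes> f x \<otimes> g x) = \<zero>" .
    qed
    finally have "card ?L + h \<le> card E"
    proof (rule power_le_imp_le_exp[rotated])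
      have "card {\<zero>, \<one>} \<le> ?q" using fin by (intro card_mono) auto
      then show "1 < ?q" by simp
    qed
    then have "(card ?L + h) * 2 ^ ?n \<le> card E * 2 ^ ?n" by simp
    \<comment> \<open>Complementation turns the lower bound on \<open>h\<close> into an upper bound
      on the low-weight part of \<open>E\<close>.\<close>
    also have "\<dots> = card E * choose_upto ?n (k + d) + card E * choose_upto ?n r"
      using choose_upto_compl[OF True] by (simp add: r_def distrib_left[symmetric])
    also have "\<dots> \<le> card E * choose_upto ?n (k + d) + h * 2 ^ ?n"
      using h by simp
    finally show ?thesis by (simp add: algebra_simps)
  qed
qed

section \<open>Biased measure of the nonzero set\<close>

text \<open>Summation by parts: \<rho>(u) is \<rho>(n) plus the telescoping differences over u \<le>
  k < n, and the difference at \<open>k\<close> is counted once for each point of level at most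
  \<open>k\<close>.\<close>

lemma sum_antitone_layers:
  fixes \<rho> :: "nat \<Rightarrow> real"
  assumes "finite A" "\<And>x. x \<in> A \<Longrightarrow> u x \<le> n"
  shows "(\<Sum>x\<in>A. \<rho> (u x)) =
    card A * \<rho> n + (\<Sum>k<n. (\<rho> k - \<rho> (Suc k)) * card {x \<in> A. u x \<le> k})"
proof -
  have "\<rho> (u x) = \<rho> n + (\<Sum>k<n. (\<rho> k - \<rho> (Suc k)) * of_bool (u x \<le> k))" if "x \<in> A" for x
  proof -
    have "(\<Sum>k<n. (\<rho> k - \<rho> (Suc k)) * of_bool (u x \<le> k)) = (\<Sum>k = u x..<n. \<rho> k - \<rho> (Suc k))"
      by (intro sum.mono_neutral_cong_right) auto
    also have "\<dots> = - (\<Sum>k = u x..<n. \<rho> (Suc k) - \<rho> k)"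
      by (simp add: sum_negf[symmetric])
    also have "\<dots> = \<rho> (u x) - \<rho> n"
      using assms(2)[OF that] by (simp add: sum_Suc_diff')
    finally show ?thesis by simp
  qed
  then have "(\<Sum>x\<in>A. \<rho> (u x)) =
      (\<Sum>x\<in>A. \<rho> n + (\<Sum>k<n. (\<rho> k - \<rho> (Suc k)) * of_bool (u x \<le> k)))"
    by (rule sum.cong[OF refl])
  also have "\<dots> = card A * \<rho> n + (\<Sum>k<n. (\<rho> k - \<rho> (Suc k)) * (\<lambda>k. \<Sum>x\<in>A. of_bool (u x \<le> k)) k)"
    by (simp only: sum.distrib sum_constant sum_distrib_left sum.swap[of _ "{..<n}" A])
  also have "(\<lambda>k. \<Sum>x\<in>A. of_bool (u x \<le> k)) = (\<lambda>k. real (card {x \<in> A. u x \<le> k}))"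
    using assms(1) by (simp add: of_bool_def sum.If_cases Int_def)
  finally show ?thesis .
qed

text \<open>The condition on sublevel sets says that \<open>u\<close> on \<open>A\<close>
  stochastically dominates \<open>v\<close> on \<open>B\<close>, so a decreasing function has the
  smaller mean on \<open>A\<close>. Cross-multiplication replaces division by |A| and |B|.\<close>

lemma sum_antitone_dominance:
  fixes \<rho> :: "nat \<Rightarrow> real"
  assumes "finite A" "\<And>x. x \<in> A \<Longrightarrow> u x \<le> n" "finite B" "\<And>y. y \<in> B \<Longrightarrow> v y \<le> n"
    and "\<And>k. k < n \<Longrightarrow> \<rho> (Suc k) \<le> \<rho> k"
    and "\<And>k. k < n \<Longrightarrow> card {x \<in> A. u x \<le> k} * card B \<le> card A * card {y \<in> B. v y \<le> k}"
  shows "card B * (\<Sum>x\<in>A. \<rho> (u x)) \<le> card A * (\<Sum>y\<in>B. \<rho> (v y))"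
proof -
  have "(\<Sum>k<n. card B * ((\<rho> k - \<rho> (Suc k)) * card {x \<in> A. u x \<le> k})) \<le>
      (\<Sum>k<n. card A * ((\<rho> k - \<rho> (Suc k)) * card {y \<in> B. v y \<le> k}))"
  proof (rule sum_mono)
    fix k assume "k \<in> {..<n}"
    then have k: "k < n" by simp
    have "real (card {x \<in> A. u x \<le> k} * card B) \<le> real (card A * card {y \<in> B. v y \<le> k})"
      using assms(6)[OF k] by (simp only: of_nat_le_iff)
    then have "(\<rho> k - \<rho> (Suc k)) * (card {x \<in> A. u x \<le> k} * card B) \<le>
        (\<rho> k - \<rho> (Suc k)) * (card A * card {y \<in> B. v y \<le> k})"
      using assms(5)[OF k] by (intro mult_left_mono) auto
    then show "card B * ((\<rho> k - \<rho> (Suc k)) * card {x \<in> A. u x \<le> k}) \<le>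
        card A * ((\<rho> k - \<rho> (Suc k)) * card {y \<in> B. v y \<le> k})"
      by (simp add: mult_ac)
  qed
  moreover have "(\<Sum>x\<in>A. \<rho> (u x)) =
      card A * \<rho> n + (\<Sum>k<n. (\<rho> k - \<rho> (Suc k)) * card {x \<in> A. u x \<le> k})"
    by (rule sum_antitone_layers[OF assms(1,2)])
  moreover have "(\<Sum>y\<in>B. \<rho> (v y)) =
      card B * \<rho> n + (\<Sum>k<n. (\<rho> k - \<rho> (Suc k)) * card {y \<in> B. v y \<le> k})"
    by (rule sum_antitone_layers[OF assms(3,4)])
  ultimately show ?thesis
    by (simp add: distrib_left sum_distrib_left[symmetric])
qed

lemma sum_Pow_biased:
  fixes a b :: real
  assumes "finite A"
  shows "(\<Sum>x\<in>Pow A. a ^ card x * b ^ (card A - card x)) = (a + b) ^ card A"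
proof -
  have "(a + b) ^ card A = (\<Prod>i\<in>A. a + b)" by simp
  also have "\<dots> = (\<Sum>x\<in>Pow A. (\<Prod>i\<in>x. a) * (\<Prod>i\<in>A - x. b))"
    using assms by (rule prod_add)
  also have "\<dots> = (\<Sum>x\<in>Pow A. a ^ card x * b ^ (card A - card x))"
    using assms by (intro sum.cong) (auto simp: card_Diff_subset finite_subset)
  finally show ?thesis by simp
qed

text \<open>Here \<open>a\<close> and \<open>b\<close> are the probabilities of the bits 1 and 0. As
  a \<le> b, the density decreases with the weight, so dominance bounds its mean over
  \<open>E\<close> by its mean over the cube at weights lowered by \<open>d\<close>. Undoing the
  shift costs \<open>b ^ d\<close> against \<open>a ^ d\<close>, and the density sums to 1.\<close>

lemma (in field) lowdeg_support_biased_le: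
  fixes a b :: real
  assumes fin: "finite (carrier R)" "finite A" and P: "P \<in> lowdeg R A d"
    and ab: "0 \<le> a" "a \<le> b" "a + b = 1"
  defines "E \<equiv> {x \<in> Pow A. P x \<noteq> \<zero>}"
  shows "2 ^ card A * (a ^ d * (\<Sum>x\<in>E. a ^ card x * b ^ (card A - card x))) \<le> b ^ d * card E"
proof -
  let ?n = "card A"
  define w where "w j = a ^ j * b ^ (?n - j)" for j
  have w_Suc: "w (Suc k) \<le> w k" if "k < ?n" for k
  proof -
    have "w (Suc k) = a * (a ^ k * b ^ (?n - Suc k))" by (simp add: w_def)
    also have "\<dots> \<le> b * (a ^ k * b ^ (?n - Suc k))"
      using ab by (intro mult_right_mono) auto
    also have "\<dots> = w k"
      using that by (simp add: w_def Suc_diff_Suc[symmetric])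
    finally show ?thesis .
  qed
  have dominance: "card (Pow A) * (\<Sum>x\<in>E. w (card x)) \<le> card E * (\<Sum>y\<in>Pow A. w (card y - d))"
  proof (rule sum_antitone_dominance[where n = ?n])
    fix k assume "k < ?n"
    \<comment> \<open>Truncated subtraction is harmless here: a lowered weight is at most
      \<open>k\<close> exactly when the weight is at most \<open>k + d\<close>, the radius in
      \<open>card_low_weight_support_le\<close>.\<close>
    have "{y \<in> Pow A. card y - d \<le> k} = {y. y \<subseteq> A \<and> card y \<le> k + d}" by auto
    then show "card {x \<in> E. card x \<le> k} * card (Pow A) \<le> card E * card {y \<in> Pow A. card y - d \<le> k}"
      using card_low_weight_support_le[OF fin P, of k] fin(2)
      by (simp add: card_subsets_upto card_Pow E_def)
  next
    show "card x \<le> ?n" if "x \<in> E" for x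
      using that fin(2) by (auto simp: E_def intro: card_mono)
    show "card y - d \<le> ?n" if "y \<in> Pow A" for y
      using that card_mono[OF fin(2), of y] by auto
  qed (use fin w_Suc in \<open>auto simp: E_def\<close>)
  have shift: "a ^ d * w (card y - d) \<le> b ^ d * w (card y)" if "y \<in> Pow A" for y
  proof -
    \<comment> \<open>For weights below \<open>d\<close> truncation lowers by \<open>e\<close> only;
      the surplus \<open>a ^ (d - e)\<close> is bounded by \<open>b ^ (d - e)\<close>.\<close>
    define e where "e = min d (card y)"
    have e: "card y - d = card y - e" "e \<le> d" "e \<le> card y" "card y \<le> ?n"
      using that fin(2) card_mono[of A y] by (auto simp: e_def)
    have "a ^ d * w (card y - d) = a ^ (d - e) * (a ^ card y * b ^ (?n - card y) * b ^ e)"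
    proof -
      have "a ^ d * a ^ (card y - e) = a ^ (d - e) * a ^ card y"
        using e by (simp add: power_add[symmetric])
      moreover have "b ^ (?n - (card y - e)) = b ^ (?n - card y) * b ^ e"
        using e by (simp add: power_add[symmetric])
      ultimately show ?thesis
        unfolding w_def e(1) by (simp add: mult.assoc[symmetric])
    qed
    also have "\<dots> \<le> b ^ (d - e) * (a ^ card y * b ^ (?n - card y) * b ^ e)"
      using ab by (intro mult_right_mono power_mono) auto
    also have "\<dots> = b ^ d * w (card y)"
    proof -
      have "b ^ d = b ^ (d - e) * b ^ e" using e by (simp add: power_add[symmetric])
      then show ?thesis by (simp add: w_def)
    qed
    finally show ?thesis .
  qed
  have "a ^ d * (\<Sum>y\<in>Pow A. w (card y - d)) \<le> b ^ d * (\<Sum>y\<in>Pow A. w (card y))"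
    unfolding sum_distrib_left by (rule sum_mono[OF shift])
  also have "(\<Sum>y\<in>Pow A. w (card y)) = 1"
    unfolding w_def sum_Pow_biased[OF fin(2)] using ab by simp
  finally have shift_sum: "a ^ d * (\<Sum>y\<in>Pow A. w (card y - d)) \<le> b ^ d" by simp
  have "2 ^ ?n * (a ^ d * (\<Sum>x\<in>E. w (card x))) = a ^ d * (card (Pow A) * (\<Sum>x\<in>E. w (card x)))"
    using fin(2) by (simp add: card_Pow)
  also have "\<dots> \<le> a ^ d * (card E * (\<Sum>y\<in>Pow A. w (card y - d)))"
    using ab by (intro mult_left_mono dominance) simp
  also have "\<dots> = card E * (a ^ d * (\<Sum>y\<in>Pow A. w (card y - d)))"
    by (rule mult.left_commute)
  also have "\<dots> \<le> card E * b ^ d"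
    by (intro mult_left_mono shift_sum) simp
  finally show ?thesis by (simp add: w_def mult.commute)
qed

section \<open>From formal polynomials to low-degree functions\<close>

lemma (in ring) indexed_pset_support:
  assumes "P \<in> indexed_pset I (carrier R)"
  shows "finite {m. P m \<noteq> \<zero>}" "\<And>m. P m \<noteq> \<zero> \<Longrightarrow> set_mset m \<subseteq> I" "\<And>m. P m \<in> carrier R"
proof -
  \<comment> \<open>Finite support makes \<open>mpoly_eval\<close> a genuine sum, as a ring sum over
    an infinite set is zero by default.\<close>
  show "finite {m. P m \<noteq> \<zero>}"
    using assms
  proof (induction rule: indexed_pset.induct)
    case (indexed_const k)
    show ?case by (rule finite_subset[of _ "{{#}}"]) (auto simp: indexed_const_def)
  next
    case (indexed_padd P Q)
    then show ?case
      by (intro finite_subset[OF _ finite_UnI[OF indexed_padd.IH]]) (auto simp: indexed_padd_def)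
  next
    case (indexed_pmult P i)
    show ?case
    proof (rule finite_subset[OF _ finite_imageI[OF indexed_pmult.IH]])
      show "{m. indexed_pmult P i m \<noteq> \<zero>} \<subseteq> add_mset i ` {m. P m \<noteq> \<zero>}"
      proof
        fix m assume "m \<in> {m. indexed_pmult P i m \<noteq> \<zero>}"
        then have "i \<in># m" "P (m - {#i#}) \<noteq> \<zero>"
          by (auto simp: indexed_pmult_def split: if_splits)
        then show "m \<in> add_mset i ` {m. P m \<noteq> \<zero>}"
          by (intro image_eqI[of _ _ "m - {#i#}"]) auto
      qed
    qed
  qed
  show "P m \<in> carrier R" for m
    using indexed_pset_in_carrier[OF subset_refl assms] by (rule carrier_coeffE)
  show "set_mset m \<subseteq> I" if "P m \<noteq> \<zero>" for m
    using assms that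
  proof (induction arbitrary: m rule: indexed_pset.induct)
    case (indexed_const k)
    then show ?case by (auto simp: indexed_const_def split: if_splits)
  next
    case (indexed_padd P Q)
    have "P m \<noteq> \<zero> \<or> Q m \<noteq> \<zero>"
      using indexed_padd.prems by (auto simp: indexed_padd_def)
    then show ?case using indexed_padd.IH by blast
  next
    case (indexed_pmult P i)
    then have m: "i \<in># m" "P (m - {#i#}) \<noteq> \<zero>"
      by (auto simp: indexed_pmult_def split: if_splits)
    have "set_mset m = insert i (set_mset (m - {#i#}))"
      using m(1) by (metis insert_DiffM set_mset_add_mset_insert)
    also have "\<dots> \<subseteq> I"
      by (rule insert_subsetI[OF indexed_pmult.hyps(2) indexed_pmult.IH[OF m(2)]])
    finally show ?case .
  qed
qed

lemma card_set_mset_le_size: "card (set_mset m) \<le> size m"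
  by (induction m) (auto simp: card_insert_if)

lemma (in cring) finprod_indicator:
  assumes "finite I" "\<And>i. i \<in> I \<Longrightarrow> k i \<noteq> 0"
  shows "(\<Otimes>i\<in>I. (if i \<in> x then \<one> else \<zero>) [^] (k i :: nat)) = (if I \<subseteq> x then \<one> else \<zero>)"
  using assms
proof (induction I rule: finite_induct)
  case (insert i I)
  then have "(\<Otimes>i\<in>insert i I. (if i \<in> x then \<one> else \<zero>) [^] k i) =
      (if i \<in> x then \<one> else \<zero>) [^] k i \<otimes> (\<Otimes>i\<in>I. (if i \<in> x then \<one> else \<zero>) [^] k i)"
    by (intro finprod_insert) auto
  also have "\<dots> = (if insert i I \<subseteq> x then \<one> else \<zero>)"
    using insert by (auto simp: nat_pow_zero)
  finally show ?case .
qed simp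

text \<open>On bits the exponents collapse: a monomial \<open>m\<close> becomes the square-free
  monomial of \<open>set_mset m\<close>, whose degree is no larger.\<close>

lemma (in cring) mpoly_eval_lowdeg:
  assumes "P \<in> indexed_pset A (carrier R)" "mpoly_degree_le R P d"
  shows "(\<lambda>x. mpoly_eval R P (\<lambda>i. if i \<in> x then \<one> else \<zero>)) \<in> lowdeg R A d"
proof -
  note supp = indexed_pset_support[OF assms(1)]
  have "(\<lambda>x. \<Oplus>m\<in>{m. P m \<noteq> \<zero>}. if set_mset m \<subseteq> x then P m else \<zero>) \<in> lowdeg R A d"
  proof (rule lowdeg_finsum[OF supp(1)])
    fix m assume "m \<in> {m. P m \<noteq> \<zero>}"
    then have "set_mset m \<subseteq> A" "card (set_mset m) \<le> d"
      using supp(2)[of m] card_set_mset_le_size[of m] assms(2)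
      by (auto simp: mpoly_degree_le_def intro: le_trans)
    then show "(\<lambda>x. if set_mset m \<subseteq> x then P m else \<zero>) \<in> lowdeg R A d"
      by (intro lowdeg.monomial supp(3)) auto
  qed
  also have "(\<lambda>x. \<Oplus>m\<in>{m. P m \<noteq> \<zero>}. if set_mset m \<subseteq> x then P m else \<zero>) =
      (\<lambda>x. mpoly_eval R P (\<lambda>i. if i \<in> x then \<one> else \<zero>))"
    unfolding mpoly_eval_def using supp(3)
    by (intro ext finsum_cong' refl) (auto simp: finprod_indicator count_eq_zero_iff)
  finally show ?thesis .
qed

section \<open>Uniform and biased distributions in terms of sets of ones\<close>

lemma cube_iff: "x \<in> cube n \<longleftrightarrow> (\<forall>i. x i \<longrightarrow> i < n)"
  unfolding cube_def PiE_dflt_def by (simp add: not_less) (metis not_less)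

lemma Collect_le_of_cube: "x \<in> cube n \<Longrightarrow> Collect x \<subseteq> {..<n}"
  by (auto simp: cube_iff)

lemma bij_betw_Collect_cube: "bij_betw Collect (cube n) (Pow {..<n})"
  by (rule bij_betw_byWitness[where f' = "\<lambda>A i. i \<in> A"]) (auto simp: cube_iff)

lemma finite_cube [simp]: "finite (cube n)"
  using bij_betw_finite[OF bij_betw_Collect_cube] by simp

lemma card_cube: "card (cube n) = 2 ^ n"
  using bij_betw_same_card[OF bij_betw_Collect_cube, of n] by (simp add: card_Pow)

lemma cube_nonempty: "cube n \<noteq> {}"
  using card_cube[of n] by auto

lemma prob_uniform_cube:
  "measure_pmf.prob (uniform_cube n) {x. f x} = card {x \<in> cube n. f x} / 2 ^ n"
  by (simp add: uniform_cube_def measure_pmf_of_set cube_nonempty card_cube Int_def)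

lemma set_biased_cube: "set_pmf (biased_cube n \<alpha>) \<subseteq> cube n"
proof
  fix x assume "x \<in> set_pmf (biased_cube n \<alpha>)"
  then have "x \<in> {f. \<forall>i. i \<notin> {..<n} \<longrightarrow> f i = False}"
    unfolding biased_cube_def by (rule subsetD[OF set_Pi_pmf_subset[OF finite_lessThan]])
  then show "x \<in> cube n" by (auto simp: cube_iff)
qed

lemma pmf_biased_cube:
  assumes "0 \<le> \<alpha>" "\<alpha> \<le> 1 / 2" "x \<in> cube n"
  shows "pmf (biased_cube n \<alpha>) x =
    (1 / 2 - \<alpha>) ^ card (Collect x) * (1 / 2 + \<alpha>) ^ (n - card (Collect x))"
proof -
  have x: "Collect x \<subseteq> {..<n}" using assms(3) by (rule Collect_le_of_cube)
  have p: "pmf (bernoulli_pmf (1 / 2 - \<alpha>)) b = (if b then 1 / 2 - \<alpha> else 1 / 2 + \<alpha>)" for b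
    using assms by (cases b) auto
  have "pmf (biased_cube n \<alpha>) x = (\<Prod>i<n. if x i then 1 / 2 - \<alpha> else 1 / 2 + \<alpha>)"
    unfolding biased_cube_def using assms(3) by (subst pmf_Pi') (auto simp: cube_iff p)
  also have "\<dots> = (\<Prod>i\<in>Collect x. 1 / 2 - \<alpha>) * (\<Prod>i\<in>{..<n} - Collect x. 1 / 2 + \<alpha>)"
    using x by (subst prod.If_cases) (auto simp: Int_absorb1 Diff_eq)
  also have "\<dots> = (1 / 2 - \<alpha>) ^ card (Collect x) * (1 / 2 + \<alpha>) ^ (n - card (Collect x))"
    using x by (simp add: card_Diff_subset finite_subset)
  finally show ?thesis .
qed

lemma prob_biased_cube:
  assumes "0 \<le> \<alpha>" "\<alpha> \<le> 1 / 2"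
  shows "measure_pmf.prob (biased_cube n \<alpha>) {x. f x} = (\<Sum>x\<in>{x \<in> cube n. f x}.
    (1 / 2 - \<alpha>) ^ card (Collect x) * (1 / 2 + \<alpha>) ^ (n - card (Collect x)))"
proof -
  have "measure_pmf.prob (biased_cube n \<alpha>) {x. f x} =
      measure_pmf.prob (biased_cube n \<alpha>) {x \<in> cube n. f x}"
  proof -
    have "{x. f x} \<inter> set_pmf (biased_cube n \<alpha>) = {x \<in> cube n. f x} \<inter> set_pmf (biased_cube n \<alpha>)"
      using set_biased_cube[of n \<alpha>] by blast
    then show ?thesis by (metis measure_Int_set_pmf)
  qed
  also have "\<dots> = (\<Sum>x\<in>{x \<in> cube n. f x}. pmf (biased_cube n \<alpha>) x)"
    by (simp add: measure_measure_pmf_finite)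
  also have "\<dots> = (\<Sum>x\<in>{x \<in> cube n. f x}.
      (1 / 2 - \<alpha>) ^ card (Collect x) * (1 / 2 + \<alpha>) ^ (n - card (Collect x)))"
    using assms by (intro sum.cong) (auto simp: pmf_biased_cube)
  finally show ?thesis .
qed

section \<open>Polynomial tests under the two distributions\<close>

lemma poly_test_biased_le:
  fixes F :: "('a, 'b) ring_scheme"
  assumes F: "field F" "finite (carrier F)" and f: "f \<in> poly_tests F n d"
    and \<alpha>: "0 \<le> \<alpha>" "\<alpha> \<le> 1 / 2"
  shows "(1 / 2 - \<alpha>) ^ d * measure_pmf.prob (biased_cube n \<alpha>) {x. f x} \<le>
    (1 / 2 + \<alpha>) ^ d * measure_pmf.prob (uniform_cube n) {x. f x}"
proof -
  interpret field F by fact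
  obtain P where P: "P \<in> indexed_pset {..<n} (carrier F)" "mpoly_degree_le F P d"
    and f_def: "f = (\<lambda>x. mpoly_eval F P (\<lambda>i. if x i then \<one>\<^bsub>F\<^esub> else \<zero>\<^bsub>F\<^esub>) \<noteq> \<zero>\<^bsub>F\<^esub>)"
    using f by (auto simp: poly_tests_def)
  define Q where "Q A = mpoly_eval F P (\<lambda>i. if i \<in> A then \<one>\<^bsub>F\<^esub> else \<zero>\<^bsub>F\<^esub>)" for A
  have Q: "Q \<in> lowdeg F {..<n} d"
    unfolding Q_def by (rule mpoly_eval_lowdeg[OF P])
  define E where "E = {A \<in> Pow {..<n}. Q A \<noteq> \<zero>\<^bsub>F\<^esub>}"
  have fQ: "f x \<longleftrightarrow> Q (Collect x) \<noteq> \<zero>\<^bsub>F\<^esub>" for x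
    by (simp add: f_def Q_def)
  have bij: "bij_betw Collect {x \<in> cube n. f x} E"
    unfolding bij_betw_def
  proof
    show "inj_on Collect {x \<in> cube n. f x}"
      by (rule inj_on_subset[OF bij_betw_imp_inj_on[OF bij_betw_Collect_cube[of n]]]) simp
    show "Collect ` {x \<in> cube n. f x} = E"
    proof -
      have "g ` {x \<in> S. p (g x)} = {A \<in> g ` S. p A}" for g :: "(nat \<Rightarrow> bool) \<Rightarrow> nat set" and S p
        by blast
      then show ?thesis
        unfolding E_def bij_betw_imp_surj_on[OF bij_betw_Collect_cube[of n], symmetric] fQ .
    qed
  qed
  \<comment> \<open>The powers stay undivided on the two sides, which admits
    \<open>\<alpha> = 1 / 2\<close>.\<close>
  have "2 ^ card {..<n} * ((1 / 2 - \<alpha>) ^ d *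
      (\<Sum>A\<in>E. (1 / 2 - \<alpha>) ^ card A * (1 / 2 + \<alpha>) ^ (card {..<n} - card A)))
      \<le> (1 / 2 + \<alpha>) ^ d * card E"
    unfolding E_def
    by (rule lowdeg_support_biased_le[OF F(2) finite_lessThan Q]) (use \<alpha> in auto)
  moreover have "(\<Sum>A\<in>E. (1 / 2 - \<alpha>) ^ card A * (1 / 2 + \<alpha>) ^ (card {..<n} - card A)) =
      measure_pmf.prob (biased_cube n \<alpha>) {x. f x}"
    unfolding prob_biased_cube[OF \<alpha>] by (subst sum.reindex_bij_betw[OF bij, symmetric]) simp
  moreover have "real (card E) = 2 ^ n * measure_pmf.prob (uniform_cube n) {x. f x}"
    by (simp add: prob_uniform_cube bij_betw_same_card[OF bij])
  ultimately have "2 ^ n * ((1 / 2 - \<alpha>) ^ d * measure_pmf.prob (biased_cube n \<alpha>) {x. f x}) \<le>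
      2 ^ n * ((1 / 2 + \<alpha>) ^ d * measure_pmf.prob (uniform_cube n) {x. f x})"
    by (simp add: mult.left_commute)
  then show ?thesis by simp
qed

text \<open>For positive \<open>d\<close> the bound on \<open>\<alpha> * d\<close> gives \<alpha>
  \<le> 1/4, where the ratio of 1/2 + \<alpha> to 1/2 - \<alpha> is at most exp(8 \<alpha>); its
  \<open>d\<close>-th power is then at most e^2 \<le> 9. For \<open>d = 0\<close> both powers are 1,
  while \<alpha> may be as large as 1/2.\<close>

lemma poly_test_biased_le_exp:
  fixes F :: "('a, 'b) ring_scheme"
  assumes F: "field F" "finite (carrier F)" and f: "f \<in> poly_tests F n d"
    and \<alpha>: "0 \<le> \<alpha>" "\<alpha> \<le> 1 / 2" "\<alpha> * d \<le> 1 / 4"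
  shows "measure_pmf.prob (biased_cube n \<alpha>) {x. f x} \<le>
    9 * measure_pmf.prob (uniform_cube n) {x. f x}"
proof (cases "d = 0")
  case True
  then have "measure_pmf.prob (biased_cube n \<alpha>) {x. f x} \<le> measure_pmf.prob (uniform_cube n) {x. f x}"
    using poly_test_biased_le[OF F f \<alpha>(1,2)] by simp
  then show ?thesis
    using measure_nonneg[of "measure_pmf (uniform_cube n)" "{x. f x}"] by linarith
next
  case False
  then have "\<alpha> * 1 \<le> \<alpha> * d" using \<alpha> by (intro mult_left_mono) auto
  then have \<alpha>4: "\<alpha> \<le> 1 / 4" using \<alpha> by simp
  have "0 \<le> \<alpha> * (1 - 4 * \<alpha>)" using \<alpha> \<alpha>4 by simp
  \<comment> \<open>The difference of the sides is 2 \<alpha> (1 - 4 \<alpha>), twice the quantity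
    above.\<close>
  then have "1 / 2 + \<alpha> \<le> (1 + 8 * \<alpha>) * (1 / 2 - \<alpha>)"
    by (simp add: algebra_simps)
  also have "\<dots> \<le> exp (8 * \<alpha>) * (1 / 2 - \<alpha>)"
    using \<alpha> by (intro mult_right_mono exp_ge_add_one_self) auto
  finally have "(1 / 2 + \<alpha>) ^ d \<le> (exp (8 * \<alpha>) * (1 / 2 - \<alpha>)) ^ d"
    using \<alpha> by (intro power_mono) auto
  also have "\<dots> = exp (8 * (\<alpha> * d)) * (1 / 2 - \<alpha>) ^ d"
    by (simp add: power_mult_distrib exp_of_nat_mult[symmetric] mult_ac)
  also have "\<dots> \<le> 9 * (1 / 2 - \<alpha>) ^ d"
  proof (rule mult_right_mono)
    have "exp (8 * (\<alpha> * d)) \<le> exp (1 + 1 :: real)" using \<alpha> by simp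
    also have "\<dots> \<le> 3 * 3" unfolding exp_add using exp_le by (intro mult_mono) auto
    finally show "exp (8 * (\<alpha> * d)) \<le> 9" by simp
  qed (use \<alpha> in auto)
  finally have *: "(1 / 2 + \<alpha>) ^ d \<le> 9 * (1 / 2 - \<alpha>) ^ d" .
  have "(1 / 2 - \<alpha>) ^ d * measure_pmf.prob (biased_cube n \<alpha>) {x. f x} \<le>
      (9 * (1 / 2 - \<alpha>) ^ d) * measure_pmf.prob (uniform_cube n) {x. f x}"
    using poly_test_biased_le[OF F f \<alpha>(1,2)] by (rule order.trans) (intro mult_right_mono * measure_nonneg)
  then have "(1 / 2 - \<alpha>) ^ d * measure_pmf.prob (biased_cube n \<alpha>) {x. f x} \<le>
      (1 / 2 - \<alpha>) ^ d * (9 * measure_pmf.prob (uniform_cube n) {x. f x})"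
    by (simp add: mult_ac)
  then show ?thesis
    using \<alpha>4 by (subst (asm) mult_le_cancel_left_pos) auto
qed

section \<open>The second moment of the bias\<close>

text \<open>The linear polynomial x_i - x_j takes the values 0, 1 and -1 on bits and vanishes only
  at equal bits, in every characteristic including 2.\<close>

lemma neq_test_in_poly_tests:
  fixes F :: "('a, 'b) ring_scheme"
  assumes "field F" "i < n" "j < n" "i \<noteq> j" "1 \<le> d"
  shows "(\<lambda>x. x i \<noteq> x j) \<in> poly_tests F n d"
proof -
  interpret field F by fact
  define P where "P = indexed_padd (indexed_var i) (indexed_pmult (indexed_const (\<ominus>\<^bsub>F\<^esub> \<one>\<^bsub>F\<^esub>)) j)"
  have P: "P m = (if m = {#i#} then \<one>\<^bsub>F\<^esub> else if m = {#j#} then \<ominus>\<^bsub>F\<^esub> \<one>\<^bsub>F\<^esub> else \<zero>\<^bsub>F\<^esub>)" for m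
  proof -
    have "k \<in># m \<and> m - {#k#} = {#} \<longleftrightarrow> m = {#k#}" for k
      by (metis add_mset_diff_bothsides cancel_comm_monoid_add_class.diff_cancel insert_DiffM multi_member_last)
    then show ?thesis
      using \<open>i \<noteq> j\<close> by (auto simp: P_def indexed_padd_def indexed_var_def indexed_pmult_def indexed_const_def)
  qed
  have "P \<in> indexed_pset {..<n} (carrier F)"
    unfolding P_def indexed_var_def using assms by (intro indexed_pset.intros) auto
  moreover have "mpoly_degree_le F P d"
    using \<open>1 \<le> d\<close> by (auto simp: mpoly_degree_le_def P)
  moreover have "mpoly_eval F P (\<lambda>i. if x i then \<one>\<^bsub>F\<^esub> else \<zero>\<^bsub>F\<^esub>) \<noteq> \<zero>\<^bsub>F\<^esub> \<longleftrightarrow> x i \<noteq> x j" for x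
  proof -
    let ?v = "\<lambda>i. if x i then \<one>\<^bsub>F\<^esub> else \<zero>\<^bsub>F\<^esub>"
    have supp: "{m. P m \<noteq> \<zero>\<^bsub>F\<^esub>} = {{#i#}, {#j#}}"
      using \<open>i \<noteq> j\<close> by (auto simp: P)
    have "mpoly_eval F P ?v = ?v i \<oplus>\<^bsub>F\<^esub> \<ominus>\<^bsub>F\<^esub> \<one>\<^bsub>F\<^esub> \<otimes>\<^bsub>F\<^esub> ?v j"
      unfolding mpoly_eval_def supp using \<open>i \<noteq> j\<close>
      by (subst finsum_insert) (auto simp: P)
    also have "\<dots> \<noteq> \<zero>\<^bsub>F\<^esub> \<longleftrightarrow> x i \<noteq> x j"
      by (auto simp: r_neg)
    finally show ?thesis .
  qed
  ultimately show ?thesis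
    unfolding poly_tests_def by (intro CollectI exI[of _ P]) auto
qed

lemma prob_uniform_cube_neq:
  assumes "i < n" "j < n" "i \<noteq> j"
  shows "measure_pmf.prob (uniform_cube n) {x. x i \<noteq> x j} = 1 / 2"
proof -
  \<comment> \<open>Flipping bit \<open>i\<close> exchanges the two events, so each fills half of
    the cube.\<close>
  have "bij_betw (\<lambda>x. x(i := \<not> x i)) {x \<in> cube n. x i \<noteq> x j} {x \<in> cube n. x i = x j}"
    by (rule bij_betw_byWitness[where f' = "\<lambda>x. x(i := \<not> x i)"]) (use assms in \<open>auto simp: cube_iff fun_upd_idem_iff split: if_splits\<close>)
  then have "card {x \<in> cube n. x i \<noteq> x j} = card {x \<in> cube n. x i = x j}"
    by (rule bij_betw_same_card)
  moreover have "card {x \<in> cube n. x i \<noteq> x j} + card {x \<in> cube n. x i = x j} = card (cube n)"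
    by (subst card_Un_disjoint[symmetric]) (auto intro!: arg_cong[of _ _ card])
  ultimately have "2 * card {x \<in> cube n. x i \<noteq> x j} = 2 ^ n" by (simp add: card_cube)
  then have "real (2 * card {x \<in> cube n. x i \<noteq> x j}) = 2 ^ n"
    by (simp only: of_nat_power of_nat_numeral)
  then show ?thesis by (simp add: prob_uniform_cube field_simps)
qed

section \<open>Moments of the sum of signs\<close>

definition sgn_bit :: "bool \<Rightarrow> real" where
  "sgn_bit b = (if b then - 1 else 1)"

lemma expectation_sgn_prod:
  fixes Y :: "'a pmf"
  shows "measure_pmf.expectation Y (\<lambda>x. sgn_bit (f x) * sgn_bit (g x)) =
    1 - 2 * measure_pmf.prob Y {x. f x \<noteq> g x}"
proof -
  have "(\<lambda>x. sgn_bit (f x) * sgn_bit (g x)) = (\<lambda>x. 1 - 2 * indicator {x. f x \<noteq> g x} x)"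
    by (auto simp: sgn_bit_def fun_eq_iff)
  moreover have "integrable (measure_pmf Y) (\<lambda>x. 2 * indicator {x. f x \<noteq> g x} x :: real)"
    by (intro integrable_mult_right measure_pmf.integrable_const_bound[where B = 1]) auto
  ultimately show ?thesis by simp
qed

lemma integrable_sgn_bit [simp]:
  "integrable (measure_pmf Y) (\<lambda>x. sgn_bit (f x))"
  by (rule measure_pmf.integrable_const_bound[where B = 1]) (auto simp: sgn_bit_def)

lemma integrable_sgn_bit_prod [simp]:
  "integrable (measure_pmf Y) (\<lambda>x. sgn_bit (f x) * sgn_bit (g x))"
  by (rule measure_pmf.integrable_const_bound[where B = 1]) (auto simp: sgn_bit_def)

lemma expectation_sgn_sum_sq_le:
  fixes Y :: "(nat \<Rightarrow> bool) pmf" and n :: nat and \<epsilon> :: real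
  assumes "\<And>i j. i < n \<Longrightarrow> j < n \<Longrightarrow> i \<noteq> j \<Longrightarrow> 1 / 2 - \<epsilon> \<le> measure_pmf.prob Y {x. x i \<noteq> x j}"
    and "0 \<le> \<epsilon>"
  shows "measure_pmf.expectation Y (\<lambda>x. (\<Sum>i<n. sgn_bit (x i))\<^sup>2) \<le> n + n * n * (2 * \<epsilon>)"
proof -
  have "measure_pmf.expectation Y (\<lambda>x. (\<Sum>i<n. sgn_bit (x i))\<^sup>2) =
      measure_pmf.expectation Y (\<lambda>x. \<Sum>i<n. \<Sum>j<n. sgn_bit (x i) * sgn_bit (x j))"
    by (simp add: power2_eq_square sum_product)
  also have "\<dots> = (\<Sum>i<n. \<Sum>j<n. 1 - 2 * measure_pmf.prob Y {x. x i \<noteq> x j})"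
    by (simp add: Bochner_Integration.integral_sum expectation_sgn_prod del: sum_subtractf)
  \<comment> \<open>A diagonal term is 1 and an off-diagonal one at most 2 \<epsilon>; granting 2
    \<epsilon> to the diagonal too keeps the sum uniform.\<close>
  also have "\<dots> \<le> (\<Sum>i<n. \<Sum>j<n. (if i = j then 1 else 0) + 2 * \<epsilon>)"
  proof (intro sum_mono)
    fix i j assume "i \<in> {..<n}" "j \<in> {..<n}"
    then show "1 - 2 * measure_pmf.prob Y {x. x i \<noteq> x j} \<le> (if i = j then 1 else 0) + 2 * \<epsilon>"
      using assms(1)[of i j] assms(2) by auto
  qed
  also have "\<dots> = n + n * n * (2 * \<epsilon>)"
    by (simp add: sum.distrib algebra_simps)
  finally show ?thesis .
qed

lemma expectation_sgn_sum_biased: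
  assumes "0 \<le> \<alpha>" "\<alpha> \<le> 1 / 2"
  shows "measure_pmf.expectation (biased_cube n \<alpha>) (\<lambda>x. \<Sum>i<n. sgn_bit (x i)) = 2 * \<alpha> * n"
proof -
  have "measure_pmf.expectation (biased_cube n \<alpha>) (\<lambda>x. sgn_bit (x i)) = 2 * \<alpha>" if "i < n" for i
  proof -
    have "measure_pmf.expectation (biased_cube n \<alpha>) (\<lambda>x. sgn_bit (x i)) =
        measure_pmf.expectation (map_pmf (\<lambda>x. x i) (biased_cube n \<alpha>)) sgn_bit"
      by simp
    also have "map_pmf (\<lambda>x. x i) (biased_cube n \<alpha>) = bernoulli_pmf (1 / 2 - \<alpha>)"
      unfolding biased_cube_def using that by (subst Pi_pmf_component) auto
    also have "measure_pmf.expectation \<dots> sgn_bit = 2 * \<alpha>"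
      using assms by (simp add: sgn_bit_def)
    finally show ?thesis .
  qed
  then show ?thesis
    by (simp add: Bochner_Integration.integral_sum)
qed

lemma dense_in_expectation_le:
  assumes "dense_in \<delta> Z Y" "finite A" "set_pmf Z \<subseteq> A" "set_pmf Y \<subseteq> A" "\<And>x. 0 \<le> f x"
  shows "\<delta> * measure_pmf.expectation Z f \<le> measure_pmf.expectation Y f"
proof -
  have "\<delta> * measure_pmf.expectation Z f = (\<Sum>x\<in>A. f x * (\<delta> * pmf Z x))"
    using assms by (subst integral_measure_pmf_real[of A]) (auto simp: sum_distrib_left mult_ac)
  also have "\<dots> \<le> (\<Sum>x\<in>A. f x * pmf Y x)"
    using assms by (intro sum_mono mult_left_mono) (auto simp: dense_in_def)
  also have "\<dots> = measure_pmf.expectation Y f"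
    using assms by (subst integral_measure_pmf_real[of A]) auto
  finally show ?thesis .
qed

text \<open>The condition \<open>big\<close> says that the lower bound
  \<open>\<delta> * (2 * \<alpha> * n)\<^sup>2\<close> forced by density exceeds the upper bound
  \<open>3 * n\<close>, both divided by \<open>n\<close>.\<close>

lemma biased_cube_not_dense_in:
  assumes F: "field F" and "1 \<le> d" and \<alpha>: "0 \<le> \<alpha>" "\<alpha> \<le> 1 / 2"
    and "0 < n" "0 \<le> \<delta>" and big: "3 < 4 * \<delta> * \<alpha>\<^sup>2 * n"
    and Y: "set_pmf Y \<subseteq> cube n" "pseudorandom (poly_tests F n d) n (1 / n) Y"
  shows "\<not> dense_in \<delta> (biased_cube n \<alpha>) Y"
proof
  assume dense: "dense_in \<delta> (biased_cube n \<alpha>) Y"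
  let ?S = "\<lambda>x :: nat \<Rightarrow> bool. \<Sum>i<n. sgn_bit (x i)" and ?Z = "biased_cube n \<alpha>"
  have "1 / 2 - 1 / n \<le> measure_pmf.prob Y {x. x i \<noteq> x j}" if "i < n" "j < n" "i \<noteq> j" for i j
  proof -
    have "\<bar>measure_pmf.prob Y {x. x i \<noteq> x j} - measure_pmf.prob (uniform_cube n) {x. x i \<noteq> x j}\<bar> \<le> 1 / n"
      using Y(2) neq_test_in_poly_tests[OF F that \<open>1 \<le> d\<close>] unfolding pseudorandom_def by blast
    then show ?thesis unfolding prob_uniform_cube_neq[OF that] by linarith
  qed
  then have "measure_pmf.expectation Y (\<lambda>x. (?S x)\<^sup>2) \<le> n + n * n * (2 * (1 / n))"
    by (intro expectation_sgn_sum_sq_le) auto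
  then have upper: "measure_pmf.expectation Y (\<lambda>x. (?S x)\<^sup>2) \<le> 3 * n"
    using \<open>0 < n\<close> by simp
  have fin: "finite (set_pmf ?Z)"
    by (rule finite_subset[OF set_biased_cube finite_cube])
  have "(2 * \<alpha> * n)\<^sup>2 = (measure_pmf.expectation ?Z ?S)\<^sup>2"
    by (simp add: expectation_sgn_sum_biased[OF \<alpha>])
  \<comment> \<open>The variance is nonnegative.\<close>
  also have "\<dots> \<le> measure_pmf.expectation ?Z (\<lambda>x. (?S x)\<^sup>2)"
    using measure_pmf.variance_positive[of ?Z ?S] fin
    by (subst (asm) measure_pmf.variance_eq) (auto intro: integrable_measure_pmf_finite)
  finally have "\<delta> * (2 * \<alpha> * n)\<^sup>2 \<le> \<delta> * measure_pmf.expectation ?Z (\<lambda>x. (?S x)\<^sup>2)"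
    using \<open>0 \<le> \<delta>\<close> by (rule mult_left_mono)
  also have "\<dots> \<le> measure_pmf.expectation Y (\<lambda>x. (?S x)\<^sup>2)"
    by (rule dense_in_expectation_le[OF dense finite_cube set_biased_cube Y(1)]) simp
  finally have "(4 * \<delta> * \<alpha>\<^sup>2 * n) * n \<le> 3 * n"
    using upper by (simp add: power2_eq_square mult_ac)
  then show False using big \<open>0 < n\<close> by simp
qed

text \<open>For \<open>d = 0\<close> every test is constant, so the biased distribution is itself
  pseudorandom and \<delta>-dense in itself; hence the guard \<open>1 \<le> d\<close> on the second
  half. The support condition makes \<open>Y\<close> a random variable on the cube, since its values
  are functions on all of \<open>nat\<close>.\<close>

theorem theorem1p6:
  shows "\<exists>c::real. 0 < c \<and> \<bar>c - 1 / 200\<bar> \<le> 1 / 2000 \<and>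
    (\<forall>p::nat. Factorial_Ring.prime p \<longrightarrow>
      (\<exists>C\<^sub>1 C\<^sub>2 :: real. 0 < C\<^sub>1 \<and> 0 < C\<^sub>2 \<and>
        (\<forall>F :: nat ring. field F \<and> finite (carrier F) \<and> ring_char F = p \<longrightarrow>
          (\<forall>(\<epsilon>::real) (\<epsilon>'::real) (\<delta>::real) (n::nat) (\<alpha>::real) (d::nat).
             0 < \<epsilon> \<and> 0 < \<epsilon>' \<and> 0 < \<delta> \<and> \<delta> < c \<and> real n = 1 / \<epsilon> \<and>
             \<alpha> = C\<^sub>2 * sqrt (\<epsilon> / \<delta>) \<and> \<alpha> \<le> 1 / 2 \<and> real d \<le> C\<^sub>1 * sqrt (\<delta> / \<epsilon>) \<longrightarrow>
             pseudodense (poly_tests F n d) n \<epsilon>' \<delta> (biased_cube n \<alpha>) \<and>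
             (1 \<le> d \<longrightarrow>
               \<not> (\<exists>Y :: (nat \<Rightarrow> bool) pmf. set_pmf Y \<subseteq> cube n \<and>
                     pseudorandom (poly_tests F n d) n \<epsilon> Y \<and>
                     dense_in \<delta> (biased_cube n \<alpha>) Y))))))"
\<comment> \<open>The choices \<open>C\<^sub>1 = 1 / 4\<close> and \<open>C\<^sub>2 = 1\<close>, the
  same for every \<open>p\<close>, give \<open>\<alpha> * d \<le> 1 / 4\<close> and
  \<open>4 * \<delta> * \<alpha>\<^sup>2 * n = 4\<close>, above the threshold 3. As 1/200 is below
  1/9, \<open>\<delta>\<close> absorbs the factor 9.\<close>
proof (rule exI[of _ "1 / 200"], intro conjI allI impI, simp, simp,
    rule exI[of _ "1 / 4"], rule exI[of _ 1], intro conjI allI impI, simp, simp)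
  fix F :: "nat ring" and \<epsilon> \<epsilon>' \<delta> \<alpha> :: real and n d p :: nat
  assume "field F \<and> finite (carrier F) \<and> ring_char F = p"
  then have F: "field F" "finite (carrier F)" by auto
  assume "0 < \<epsilon> \<and> 0 < \<epsilon>' \<and> 0 < \<delta> \<and> \<delta> < 1 / 200 \<and> real n = 1 / \<epsilon> \<and>
    \<alpha> = 1 * sqrt (\<epsilon> / \<delta>) \<and> \<alpha> \<le> 1 / 2 \<and> real d \<le> 1 / 4 * sqrt (\<delta> / \<epsilon>)"
  then have \<epsilon>: "0 < \<epsilon>" "0 < \<epsilon>'" and \<delta>: "0 < \<delta>" "\<delta> < 1 / 200" and n: "real n = 1 / \<epsilon>"
    and \<alpha>: "\<alpha> = sqrt (\<epsilon> / \<delta>)" "\<alpha> \<le> 1 / 2" and d: "real d \<le> 1 / 4 * sqrt (\<delta> / \<epsilon>)"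
    by auto
  have \<alpha>0: "0 \<le> \<alpha>" using \<alpha> \<epsilon> \<delta> by simp
  have \<epsilon>n: "\<epsilon> = 1 / n" using n \<epsilon> by simp
  have "\<alpha> * d \<le> \<alpha> * (1 / 4 * sqrt (\<delta> / \<epsilon>))" using d \<alpha>0 by (rule mult_left_mono)
  also have "\<dots> = 1 / 4" using \<epsilon> \<delta> by (simp add: \<alpha>(1) real_sqrt_mult[symmetric])
  finally have \<alpha>d: "\<alpha> * d \<le> 1 / 4" .
  show "pseudodense (poly_tests F n d) n \<epsilon>' \<delta> (biased_cube n \<alpha>)"
    unfolding pseudodense_def
  proof
    fix f assume f: "f \<in> poly_tests F n d"
    let ?u = "measure_pmf.prob (uniform_cube n) {x. f x}"
    have "\<delta> * measure_pmf.prob (biased_cube n \<alpha>) {x. f x} \<le> \<delta> * (9 * ?u)"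
      using \<delta> by (intro mult_left_mono poly_test_biased_le_exp[OF F f \<alpha>0 \<alpha>(2) \<alpha>d]) simp
    also have "\<dots> \<le> 1 * ?u"
      unfolding mult.assoc[symmetric] using \<delta> by (intro mult_right_mono) auto
    finally show "\<delta> * measure_pmf.prob (biased_cube n \<alpha>) {x. f x} \<le> ?u + \<epsilon>'"
      using \<epsilon> by simp
  qed
  assume "1 \<le> d"
  have "0 < n" using n \<epsilon> by (cases n) auto
  moreover have "4 * \<delta> * \<alpha>\<^sup>2 * n = 4"
    using \<epsilon> \<delta> by (simp add: \<alpha>(1) n)
  ultimately show "\<not> (\<exists>Y :: (nat \<Rightarrow> bool) pmf. set_pmf Y \<subseteq> cube n \<and>
      pseudorandom (poly_tests F n d) n \<epsilon> Y \<and> dense_in \<delta> (biased_cube n \<alpha>) Y)"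
    using biased_cube_not_dense_in[OF F(1) \<open>1 \<le> d\<close> \<alpha>0 \<alpha>(2), of n \<delta>] \<delta> unfolding \<epsilon>n by auto
qed

end
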